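(* Let $Q=(Q_0,Q_1)$ be a quiver. The space of representations of $Q$ in the category $\mathrm{pS}$ of prespectral triples is $$\mathrm{Rep}_{\mathrm{pS}}(Q)=\coprod_{\substack{\text{Bratteli networks}\\ (\mathbf n_Q,\mathbf r_Q)}}\Big\{\prod_{e\in Q_1}\mathrm U\big(\mathbf n_{t(e)}\big)\Big\},$$ where the disjoint union is over all integers $(\mathbf n_v,\mathbf r_v)_{v\in Q_0}$ that yield Bratteli networks over $Q$, and $\mathrm U(\mathbf n)=\prod_{j}\mathrm U(n_j)$.
   Context: A quiver $Q=(Q_0,Q_1)$ is a directed multigraph (self-loops allowed) with finite vertex set $Q_0$, finite edge set $Q_1$ and source and target maps $s,t$. A prespectral triple $X=(A,\lambda,H)$ consists of a finite-dimensional unital complex $*$-algebra $A$, a finite-dimensional complex Hilbert space $H$, and a faithful $*$-action $\lambda$ of $A$ on $H$. A morphism $(A,\lambda,H)\to(A',\lambda',H')$ in the category $\mathrm{pS}$ is represented by a pair $(\phi,L)$ with $\phi:A\to A'$ a unital $*$-algebra map and $L:H\to H'$ unitary such that $\lambda'(\phi(a))=L\lambda(a)L^*$ for all $a\in A$; two pairs $(\phi_1,L_1),(\phi_2,L_2)$ are identified if $\phi_1=\phi_2=:\phi$ and $L_1\lambda(a)L_1^*=\lambda'(\phi(a))=L_2\lambda(a)L_2^*$ for all $a$. Objects are parametrised as $X(\mathbf n,\mathbf r)$, $\mathbf n,\mathbf r\in\mathbb Z_{>0}^l$, where $A=\bigoplus_{j=1}^lM_{n_j}(\mathbb C)$ acts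 on $H=\bigoplus_{j=1}^l\mathbb C^{r_j}\otimes\mathbb C^{n_j}$ by $(a_j)_j\mapsto\bigoplus_j1_{r_j}\otimes a_j$. $\mathrm{Rep}_{\mathrm{pS}}(Q)$ is the set of functors from the free (path) category of $Q$ to $\mathrm{pS}$; a representation is determined by objects $X_v$, $v\in Q_0$, and morphisms $\Phi_e:X_{s(e)}\to X_{t(e)}$, $e\in Q_1$. A Bratteli network over $Q$ consists of a positive integer $l_v$ and tuples $\mathbf n_v,\mathbf r_v\in\mathbb Z_{>0}^{l_v}$ for each $v\in Q_0$, and for each $e\in Q_1$ a matrix $C_e\in M_{l_{s(e)}\times l_{t(e)}}(\mathbb Z_{\ge0})$ with $\mathbf n_{t(e)}=C_e^{T}\mathbf n_{s(e)}$ and $\mathbf r_{s(e)}=C_e\mathbf r_{t(e)}$. It is denoted $(\mathbf n_Q,\mathbf r_Q)$, leaving the data $C$ implicit. Meaning of the equality: the element $(u_e)_{e\in Q_1}$ in the component of a Bratteli network represents the representation with $X_v=X(\mathbf n_v,\mathbf r_v)$ and with $\Phi_e$ having underlying algebra map $a\mapsto u_e\,\mathscr B_e(a)\,u_e^*$, where $\mathscr B_e:A_{s(e)}\to A_{t(e)}$ is the block embedding placing $(C_e)_{i,j}$ diagonal copies of the $i$-th block into the $j$-th block. This is a parametrisation by diagrams and unitaries; unitaries inducing the same algebra map are not identified. *)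

theory Defs
  imports
    "Graph_Theory.Digraph"
    "Graph_Theory.Arc_Walk"
    "Jordan_Normal_Form.Schur_Decomposition"
    "Jordan_Normal_Form.VS_Connect"
    "HOL-Library.FuncSet"
begin

section \<open>Prespectral triples\<close>

record 'a star_alg = "(complex, 'a) module" +
  star :: "'a \<Rightarrow> 'a"

record 'h hilb = "(complex, 'h) module" +
  inner :: "'h \<Rightarrow> 'h \<Rightarrow> complex"

locale fd_star_algebra =
  alg: ring A + vs: vectorspace "class_ring :: complex ring" A
  for A :: "('a, 'm) star_alg_scheme" (structure) +
  assumes fin_dim: "vs.fin_dim"
    and smult_mult: "\<lbrakk>a \<in> carrier A; b \<in> carrier A\<rbrakk> \<Longrightarrow> (c \<odot> a) \<otimes> b = c \<odot> (a \<otimes> b)"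
    and mult_smult: "\<lbrakk>a \<in> carrier A; b \<in> carrier A\<rbrakk> \<Longrightarrow> a \<otimes> (c \<odot> b) = c \<odot> (a \<otimes> b)"
    and star_closed: "a \<in> carrier A \<Longrightarrow> star A a \<in> carrier A"
    and star_star: "a \<in> carrier A \<Longrightarrow> star A (star A a) = a"
    and star_add: "\<lbrakk>a \<in> carrier A; b \<in> carrier A\<rbrakk> \<Longrightarrow> star A (a \<oplus> b) = star A a \<oplus> star A b"
    and star_smult: "a \<in> carrier A \<Longrightarrow> star A (c \<odot> a) = cnj c \<odot> star A a"
    and star_mult: "\<lbrakk>a \<in> carrier A; b \<in> carrier A\<rbrakk> \<Longrightarrow> star A (a \<otimes> b) = star A b \<otimes> star A a"

text \<open>Completeness is automatic in finite dimension. The inner product is linear in its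
  first argument, as is \<open>\<bullet>c\<close> on complex vectors.\<close>

locale fd_hilbert =
  vs: vectorspace "class_ring :: complex ring" H
  for H :: "('h, 'm) hilb_scheme" (structure) +
  assumes fin_dim: "vs.fin_dim"
    and inner_add: "\<lbrakk>u \<in> carrier H; v \<in> carrier H; w \<in> carrier H\<rbrakk>
      \<Longrightarrow> inner H (u \<oplus> v) w = inner H u w + inner H v w"
    and inner_smult: "\<lbrakk>v \<in> carrier H; w \<in> carrier H\<rbrakk>
      \<Longrightarrow> inner H (c \<odot> v) w = c * inner H v w"
    and inner_cnj: "\<lbrakk>v \<in> carrier H; w \<in> carrier H\<rbrakk> \<Longrightarrow> inner H w v = cnj (inner H v w)"
    and inner_pos: "\<lbrakk>v \<in> carrier H; v \<noteq> \<zero>\<rbrakk> \<Longrightarrow> Im (inner H v v) = 0 \<and> 0 < Re (inner H v v)"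

type_synonym ('a, 'h) triple = "'a star_alg \<times> ('a \<Rightarrow> 'h \<Rightarrow> 'h) \<times> 'h hilb"

definition is_star_action :: "'a star_alg \<Rightarrow> ('a \<Rightarrow> 'h \<Rightarrow> 'h) \<Rightarrow> 'h hilb \<Rightarrow> bool" where
  "is_star_action A lam H \<longleftrightarrow>
     (\<forall>a\<in>carrier A. lam a \<in> module_hom (class_ring :: complex ring) H H) \<and>
     (\<forall>a\<in>carrier A. \<forall>b\<in>carrier A. \<forall>v\<in>carrier H.
        lam (a \<oplus>\<^bsub>A\<^esub> b) v = lam a v \<oplus>\<^bsub>H\<^esub> lam b v \<and>
        lam (a \<otimes>\<^bsub>A\<^esub> b) v = lam a (lam b v)) \<and>
     (\<forall>c. \<forall>a\<in>carrier A. \<forall>v\<in>carrier H. lam (c \<odot>\<^bsub>A\<^esub> a) v = c \<odot>\<^bsub>H\<^esub> lam a v) \<and>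
     (\<forall>v\<in>carrier H. lam \<one>\<^bsub>A\<^esub> v = v) \<and>
     (\<forall>a\<in>carrier A. \<forall>v\<in>carrier H. \<forall>w\<in>carrier H.
        inner H (lam a v) w = inner H v (lam (star A a) w))"

definition prespectral_triple :: "('a, 'h) triple \<Rightarrow> bool" where
  "prespectral_triple = (\<lambda>(A, lam, H).
     fd_star_algebra A \<and> fd_hilbert H \<and> is_star_action A lam H \<and>
     (\<forall>a\<in>carrier A. \<forall>b\<in>carrier A.
        (\<forall>v\<in>carrier H. lam a v = lam b v) \<longrightarrow> a = b))"

section \<open>Morphisms\<close>

definition star_alg_hom :: "'a star_alg \<Rightarrow> 'b star_alg \<Rightarrow> ('a \<Rightarrow> 'b) set" where
  "star_alg_hom A B = {\<phi> \<in> Ring.ring_hom A B.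
     (\<forall>c. \<forall>a\<in>carrier A. \<phi> (c \<odot>\<^bsub>A\<^esub> a) = c \<odot>\<^bsub>B\<^esub> \<phi> a) \<and>
     (\<forall>a\<in>carrier A. \<phi> (star A a) = star B (\<phi> a))}"

definition unitary_maps :: "'h hilb \<Rightarrow> 'k hilb \<Rightarrow> ('h \<Rightarrow> 'k) set" where
  "unitary_maps H K = {L \<in> module_hom (class_ring :: complex ring) H K.
     bij_betw L (carrier H) (carrier K) \<and>
     (\<forall>v\<in>carrier H. \<forall>w\<in>carrier H. inner K (L v) (L w) = inner H v w)}"

definition adjoint_map :: "'h hilb \<Rightarrow> 'k hilb \<Rightarrow> ('h \<Rightarrow> 'k) \<Rightarrow> 'k \<Rightarrow> 'h" where
  "adjoint_map H K L = (\<lambda>w\<in>carrier K.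
     THE v. v \<in> carrier H \<and> (\<forall>u\<in>carrier H. inner H u v = inner K (L u) w))"

text \<open>Here and below maps are extensional, so that equality of functions is equality on
  the carrier.\<close>

definition pS_pairs :: "('a, 'h) triple \<Rightarrow> ('b, 'k) triple \<Rightarrow> (('a \<Rightarrow> 'b) \<times> ('h \<Rightarrow> 'k)) set" where
  "pS_pairs = (\<lambda>(A, lam, H) (A', lam', H').
     {(\<phi>, L). \<phi> \<in> star_alg_hom A A' \<and> \<phi> \<in> extensional (carrier A) \<and>
        L \<in> unitary_maps H H' \<and> L \<in> extensional (carrier H) \<and>
        (\<forall>a\<in>carrier A. \<forall>w\<in>carrier H'. lam' (\<phi> a) w = L (lam a (adjoint_map H H' L w)))})"

definition pS_rel :: "('a, 'h) triple \<Rightarrow> ('b, 'k) triple \<Rightarrow>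
    ((('a \<Rightarrow> 'b) \<times> ('h \<Rightarrow> 'k)) \<times> (('a \<Rightarrow> 'b) \<times> ('h \<Rightarrow> 'k))) set" where
  "pS_rel = (\<lambda>(A, lam, H) (A', lam', H').
     {((\<phi>1, L1), (\<phi>2, L2)).
        (\<phi>1, L1) \<in> pS_pairs (A, lam, H) (A', lam', H') \<and>
        (\<phi>2, L2) \<in> pS_pairs (A, lam, H) (A', lam', H') \<and>
        \<phi>1 = \<phi>2 \<and>
        (\<forall>a\<in>carrier A. \<forall>w\<in>carrier H'.
           L1 (lam a (adjoint_map H H' L1 w)) = lam' (\<phi>1 a) w \<and>
           lam' (\<phi>1 a) w = L2 (lam a (adjoint_map H H' L2 w)))})"

type_synonym ('a, 'h, 'b, 'k) pS_mor = "(('a \<Rightarrow> 'b) \<times> ('h \<Rightarrow> 'k)) set"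

definition pS_hom :: "('a, 'h) triple \<Rightarrow> ('b, 'k) triple \<Rightarrow> ('a, 'h, 'b, 'k) pS_mor set" where
  "pS_hom X Y = pS_pairs X Y // pS_rel X Y"

definition pS_id :: "('a, 'h) triple \<Rightarrow> ('a, 'h, 'a, 'h) pS_mor" where
  "pS_id = (\<lambda>(A, lam, H).
     pS_rel (A, lam, H) (A, lam, H) `` {(\<lambda>a\<in>carrier A. a, \<lambda>v\<in>carrier H. v)})"

definition pS_comp :: "('a, 'h) triple \<Rightarrow> ('c, 'l) triple \<Rightarrow>
    ('b, 'k, 'c, 'l) pS_mor \<Rightarrow> ('a, 'h, 'b, 'k) pS_mor \<Rightarrow> ('a, 'h, 'c, 'l) pS_mor" where
  "pS_comp = (\<lambda>(A, lam, H) Z \<Psi> \<Phi>.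
     \<Union>(\<psi>, M)\<in>\<Psi>. \<Union>(\<phi>, L)\<in>\<Phi>.
       pS_rel (A, lam, H) Z `` {(compose (carrier A) \<psi> \<phi>, compose (carrier H) M L)})"

section \<open>The objects $X(\mathbf n, \mathbf r)$\<close>

definition matrix_tuples :: "nat list \<Rightarrow> complex mat list set" where
  "matrix_tuples ns = {as. length as = length ns \<and>
     (\<forall>j<length ns. as ! j \<in> carrier_mat (ns ! j) (ns ! j))}"

definition matrix_alg :: "nat list \<Rightarrow> complex mat list star_alg" where
  "matrix_alg ns = \<lparr>
     carrier = matrix_tuples ns,
     monoid.mult = map2 (*),
     one = map 1\<^sub>m ns,
     zero = map (\<lambda>k. 0\<^sub>m k k) ns,
     add = map2 (+),
     module.smult = (\<lambda>c. map (smult_mat c)),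
     star = map mat_adjoint\<rparr>"

definition std_hilb :: "nat \<Rightarrow> complex vec hilb" where
  "std_hilb d = module.extend (module_vec TYPE(complex) d) (hilb.fields (\<lambda>v w. v \<bullet>c w))"

text \<open>\<open>\<complex>\<^sup>r \<otimes> \<complex>\<^sup>n\<close> is identified with \<open>r\<close> consecutive copies of \<open>\<complex>\<^sup>n\<close>, so that
  \<open>1\<^sub>r \<otimes> a\<close> is block diagonal with \<open>r\<close> blocks \<open>a\<close>.\<close>

definition std_action :: "nat list \<Rightarrow> complex mat list \<Rightarrow> complex vec \<Rightarrow> complex vec" where
  "std_action rs as v = diag_block_mat (concat (map2 replicate rs as)) *\<^sub>v v"

type_synonym std_triple = "(complex mat list, complex vec) triple"

definition X_obj :: "nat list \<Rightarrow> nat list \<Rightarrow> std_triple" where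
  "X_obj ns rs = (matrix_alg ns, std_action rs, std_hilb (sum_list (map2 (*) rs ns)))"

definition pos_tuples :: "nat \<Rightarrow> nat list set" where
  "pos_tuples l = {ns. length ns = l \<and> (\<forall>k\<in>set ns. 0 < k)}"

text \<open>Every prespectral triple on a nonzero space is isomorphic to some $X(\mathbf n, \mathbf r)$;
  these are the objects of the category used here.\<close>

definition pS_objects :: "std_triple set" where
  "pS_objects = {X. prespectral_triple X \<and>
     (\<exists>l>0. \<exists>ns\<in>pos_tuples l. \<exists>rs\<in>pos_tuples l. X = X_obj ns rs)}"

section \<open>Representations of a quiver\<close>

text \<open>The arrows of the path category are the triples \<open>(u, p, v)\<close> with \<open>p\<close> an arc walk from
  \<open>u\<close> to \<open>v\<close>; the empty walk is the identity of its vertex and \<open>p @ q\<close> is first \<open>p\<close>, then \<open>q\<close>.\<close>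

definition path_arrows :: "('v, 'e) pre_digraph \<Rightarrow> ('v \<times> 'e list \<times> 'v) set" where
  "path_arrows Q = {(u, p, v). pre_digraph.awalk Q u p v}"

type_synonym std_mor = "(complex mat list, complex vec, complex mat list, complex vec) pS_mor"

type_synonym ('v, 'e) rep = "('v \<Rightarrow> std_triple) \<times> ('v \<times> 'e list \<times> 'v \<Rightarrow> std_mor)"

definition Rep_pS :: "('v, 'e) pre_digraph \<Rightarrow> ('v, 'e) rep set" where
  "Rep_pS Q = {(X, \<Phi>).
     X \<in> verts Q \<rightarrow>\<^sub>E pS_objects \<and>
     \<Phi> \<in> extensional (path_arrows Q) \<and>
     (\<forall>u p v. (u, p, v) \<in> path_arrows Q \<longrightarrow> \<Phi> (u, p, v) \<in> pS_hom (X u) (X v)) \<and>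
     (\<forall>v\<in>verts Q. \<Phi> (v, [], v) = pS_id (X v)) \<and>
     (\<forall>u p v q w. (u, p, v) \<in> path_arrows Q \<longrightarrow> (v, q, w) \<in> path_arrows Q \<longrightarrow>
        \<Phi> (u, p @ q, w) = pS_comp (X u) (X w) (\<Phi> (v, q, w)) (\<Phi> (u, p, v)))}"

section \<open>Bratteli networks and the parametrisation\<close>

text \<open>A network is \<open>(n, r, C)\<close>; the number $l_v$ is the common length of \<open>n v\<close> and \<open>r v\<close>.\<close>

type_synonym ('v, 'e) network = "('v \<Rightarrow> nat list) \<times> ('v \<Rightarrow> nat list) \<times> ('e \<Rightarrow> nat mat)"

definition bratteli_networks :: "('v, 'e) pre_digraph \<Rightarrow> ('v, 'e) network set" where
  "bratteli_networks Q = {(n, r, C).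
     n \<in> extensional (verts Q) \<and> r \<in> extensional (verts Q) \<and> C \<in> extensional (arcs Q) \<and>
     (\<forall>v\<in>verts Q. \<exists>l>0. n v \<in> pos_tuples l \<and> r v \<in> pos_tuples l) \<and>
     (\<forall>e\<in>arcs Q.
        C e \<in> carrier_mat (length (n (tail Q e))) (length (n (head Q e))) \<and>
        vec_of_list (n (head Q e)) = transpose_mat (C e) *\<^sub>v vec_of_list (n (tail Q e)) \<and>
        vec_of_list (r (tail Q e)) = C e *\<^sub>v vec_of_list (r (head Q e)))}"

definition unitary_group :: "nat \<Rightarrow> complex mat set" where
  "unitary_group k = {U \<in> carrier_mat k k.
     U * mat_adjoint U = 1\<^sub>m k \<and> mat_adjoint U * U = 1\<^sub>m k}"

definition unitary_tuples :: "nat list \<Rightarrow> complex mat list set" where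
  "unitary_tuples ns = {us. length us = length ns \<and>
     (\<forall>j<length ns. us ! j \<in> unitary_group (ns ! j))}"

definition block_embedding :: "nat mat \<Rightarrow> complex mat list \<Rightarrow> complex mat list" where
  "block_embedding C as = map (\<lambda>j.
     diag_block_mat (concat (map (\<lambda>i. replicate (C $$ (i, j)) (as ! i)) [0..<dim_row C])))
     [0..<dim_col C]"

definition conj_tuple :: "complex mat list \<Rightarrow> complex mat list \<Rightarrow> complex mat list" where
  "conj_tuple us as = map2 (\<lambda>U a. U * a * mat_adjoint U) us as"

definition network_coproduct ::
    "('v, 'e) pre_digraph \<Rightarrow> (('v, 'e) network \<times> ('e \<Rightarrow> complex mat list)) set" where
  "network_coproduct Q =
     (SIGMA (n, r, C) : bratteli_networks Q. \<Pi>\<^sub>E e\<in>arcs Q. unitary_tuples (n (head Q e)))"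

text \<open>All representatives of a morphism have the same algebra map, so the image of a class
  under \<open>fst\<close> is the singleton of its underlying algebra map.\<close>

definition represents ::
    "('v, 'e) pre_digraph \<Rightarrow> ('v, 'e) network \<times> ('e \<Rightarrow> complex mat list) \<Rightarrow> ('v, 'e) rep \<Rightarrow> bool" where
  "represents Q = (\<lambda>((n, r, C), u) (X, \<Phi>).
     (\<forall>v\<in>verts Q. X v = X_obj (n v) (r v)) \<and>
     (\<forall>e\<in>arcs Q. fst ` \<Phi> (tail Q e, [e], head Q e) =
        {\<lambda>a\<in>carrier (matrix_alg (n (tail Q e))). conj_tuple (u e) (block_embedding (C e) a)}))"

end

theory Submission
  imports Defs
begin

text \<open>
  Fix objects \<open>X(n, r)\<close> at the vertices. A morphism of \<open>pS\<close> is an equivalence class of pairs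
  \<open>(\<phi>, L)\<close>, and the equivalence forgets exactly \<open>L\<close>: both pairs already satisfy the intertwining
  relation, so two pairs are identified as soon as they have the same \<open>\<phi>\<close>. Morphisms are therefore
  the same thing as those unital *-maps \<open>\<phi>\<close> for which some implementing unitary \<open>L\<close> exists
  (\<open>alg_maps\<close>, \<open>pS_hom_eq\<close>), and they compose like the maps \<open>\<phi>\<close> (\<open>alg_maps_compose\<close>). As the path
  category is free, a representation amounts to a free choice of one such map for each arc
  (\<open>rep_extends_arcs\<close>, \<open>rep_determined_by_arcs\<close>).

  What remains is a question about one arc: which *-maps \<open>\<phi>\<close> from \<open>\<Oplus>\<^sub>i M(n\<^sub>i)\<close> to \<open>\<Oplus>\<^sub>j M(m\<^sub>j)\<close> are
  there, and which of them are implemented by unitaries? Both answers come from one theorem about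
  a unital *-representation \<open>\<psi>\<close> of \<open>\<Oplus>\<^sub>i M(n\<^sub>i)\<close> on \<open>\<complex>\<^sup>d\<close> (\<open>unitarily_standard\<close>): \<open>\<psi>\<close> is unitarily
  equivalent to the block diagonal representation in which the \<open>i\<close>-th summand occurs \<open>c\<^sub>i\<close> times,
  where \<open>c\<^sub>i\<close> is the trace of \<open>\<psi>\<close> at a minimal projection of the \<open>i\<close>-th summand. To see this, take an
  orthonormal basis of the range of that projection's image. Each basis vector generates an isometric
  copy of \<open>\<complex>\<^bsup>n\<^sub>i\<^esup>\<close> inside \<open>\<complex>\<^sup>d\<close> that intertwines \<open>\<psi>\<close> with the \<open>i\<close>-th coordinate, and the copies are
  pairwise orthogonal. Their dimensions add up to \<open>d\<close> because the trace of \<open>\<psi>\<close> is determined by its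
  values \<open>c\<^sub>i\<close> (\<open>trace_rep\<close>), so the copies, put side by side, form a unitary matrix.

  Applied to the \<open>j\<close>-th component of \<open>\<phi>\<close>, the theorem produces column \<open>j\<close> of the Bratteli diagram,
  the relation between the dimension vectors, and the \<open>j\<close>-th unitary. Applied to the representation of
  the source algebra on the target Hilbert space, it shows that \<open>\<phi>\<close> is implemented by a unitary if and
  only if this representation has the multiplicities \<open>r\<close> of the source object
  (\<open>alg_maps_X_obj_iff\<close>); evaluating traces turns this condition into the relation between the
  multiplicity vectors. Traces also recover the entries of the diagram from \<open>\<phi>\<close>, whichever unitary
  was used to describe it (\<open>trace_diagram_map\<close>), which is why the components of the
  coproduct are disjoint.
\<close>

section \<open>Adjoints, traces and rank-one matrices\<close>

lemma mat_adjoint_eq: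
  "mat_adjoint A = mat (dim_col A) (dim_row A) (\<lambda>(i, j). conjugate (A $$ (j, i)))"
  by (rule eq_matI) (auto simp: mat_adjoint_def mat_of_rows_def)

lemma dim_mat_adjoint [simp]:
  "dim_row (mat_adjoint A) = dim_col A" "dim_col (mat_adjoint A) = dim_row A"
  by (auto simp: mat_adjoint_eq)

lemma mat_adjoint_carrier [simp]: "A \<in> carrier_mat n m \<Longrightarrow> mat_adjoint A \<in> carrier_mat m n"
  by (rule carrier_matI) simp_all

lemma index_mat_adjoint [simp]:
  "i < dim_col A \<Longrightarrow> j < dim_row A \<Longrightarrow> mat_adjoint A $$ (i, j) = conjugate (A $$ (j, i))"
  by (simp add: mat_adjoint_eq)

lemma mat_adjoint_adjoint [simp]: "mat_adjoint (mat_adjoint A) = A"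
  by (rule eq_matI) auto

lemma mat_adjoint_add:
  "A \<in> carrier_mat n m \<Longrightarrow> B \<in> carrier_mat n m \<Longrightarrow>
    mat_adjoint (A + B) = mat_adjoint A + mat_adjoint (B :: complex mat)"
  by (rule eq_matI) auto

lemma mat_adjoint_smult: "mat_adjoint (c \<cdot>\<^sub>m A) = cnj c \<cdot>\<^sub>m mat_adjoint (A :: complex mat)"
  by (rule eq_matI) auto

lemma mat_adjoint_mult:
  fixes A :: "complex mat"
  assumes "A \<in> carrier_mat n m" "B \<in> carrier_mat m k"
  shows "mat_adjoint (A * B) = mat_adjoint B * mat_adjoint A"
  using assms by (intro eq_matI) (auto simp: scalar_prod_def mult.commute)

lemma mat_adjoint_zero [simp]: "mat_adjoint (0\<^sub>m n m :: complex mat) = 0\<^sub>m m n"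
  by (rule eq_matI) auto

lemma mat_adjoint_four_block:
  fixes A :: "complex mat"
  assumes "A \<in> carrier_mat n m" "B \<in> carrier_mat n k" "C \<in> carrier_mat p m" "D \<in> carrier_mat p k"
  shows "mat_adjoint (four_block_mat A B C D) =
    four_block_mat (mat_adjoint A) (mat_adjoint C) (mat_adjoint B) (mat_adjoint D)"
  using assms by (intro eq_matI) auto

lemma inner_mult_mat_vec:
  fixes A :: "complex mat"
  assumes "A \<in> carrier_mat n m" "v \<in> carrier_vec m" "w \<in> carrier_vec n"
  shows "(A *\<^sub>v v) \<bullet>c w = v \<bullet>c (mat_adjoint A *\<^sub>v w)"
proof -
  have "(A *\<^sub>v v) \<bullet>c w = (\<Sum>i<n. \<Sum>j<m. A $$ (i, j) * v $ j * cnj (w $ i))"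
    using assms by (auto simp: scalar_prod_def sum_distrib_right atLeast0LessThan intro!: sum.cong)
  also have "\<dots> = (\<Sum>j<m. \<Sum>i<n. A $$ (i, j) * v $ j * cnj (w $ i))"
    by (rule sum.swap)
  also have "\<dots> = v \<bullet>c (mat_adjoint A *\<^sub>v w)"
    using assms by (auto simp: scalar_prod_def sum_distrib_left atLeast0LessThan ac_simps intro!: sum.cong)
  finally show ?thesis .
qed

definition trace :: "complex mat \<Rightarrow> complex" where
  "trace A = (\<Sum>i<dim_row A. A $$ (i, i))"

lemma trace_mult_comm:
  assumes "A \<in> carrier_mat n m" "B \<in> carrier_mat m n"
  shows "trace (A * B) = trace (B * A)"
proof -
  have "trace (A * B) = (\<Sum>i<n. \<Sum>j<m. A $$ (i, j) * B $$ (j, i))"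
    using assms by (auto simp: trace_def scalar_prod_def atLeast0LessThan intro!: sum.cong)
  also have "\<dots> = (\<Sum>j<m. \<Sum>i<n. A $$ (i, j) * B $$ (j, i))"
    by (rule sum.swap)
  also have "\<dots> = trace (B * A)"
    using assms
    by (auto simp: trace_def scalar_prod_def atLeast0LessThan mult.commute intro!: sum.cong)
  finally show ?thesis .
qed

lemma trace_add:
  "A \<in> carrier_mat n n \<Longrightarrow> B \<in> carrier_mat n n \<Longrightarrow> trace (A + B) = trace A + trace B"
  by (auto simp: trace_def sum.distrib)

lemma trace_smult: "A \<in> carrier_mat n n \<Longrightarrow> trace (c \<cdot>\<^sub>m A) = c * trace A"
  by (auto simp: trace_def sum_distrib_left)

lemma trace_one [simp]: "trace (1\<^sub>m n) = of_nat n"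
  by (auto simp: trace_def)

lemma trace_zero [simp]: "trace (0\<^sub>m n n) = 0"
  by (auto simp: trace_def)

lemma trace_conj:
  assumes "U \<in> carrier_mat n m" "V \<in> carrier_mat m n" "V * U = 1\<^sub>m m" "A \<in> carrier_mat m m"
  shows "trace (U * A * V) = trace A"
proof -
  have "trace (U * A * V) = trace (V * (U * A))"
    using assms by (intro trace_mult_comm) auto
  also have "V * (U * A) = A"
    using assms assoc_mult_mat[of V m n U m A m] by simp
  finally show ?thesis .
qed

definition rank_one :: "complex vec \<Rightarrow> complex vec \<Rightarrow> complex mat" where
  "rank_one v w = mat (dim_vec v) (dim_vec w) (\<lambda>(i, j). v $ i * cnj (w $ j))"

lemma rank_one_carrier [simp]:
  "v \<in> carrier_vec n \<Longrightarrow> w \<in> carrier_vec m \<Longrightarrow> rank_one v w \<in> carrier_mat n m"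
  by (auto simp: rank_one_def)

lemma dim_rank_one [simp]: "dim_row (rank_one v w) = dim_vec v" "dim_col (rank_one v w) = dim_vec w"
  by (auto simp: rank_one_def)

lemma index_rank_one [simp]:
  "i < dim_vec v \<Longrightarrow> j < dim_vec w \<Longrightarrow> rank_one v w $$ (i, j) = v $ i * cnj (w $ j)"
  by (simp add: rank_one_def)

lemma mult_rank_one:
  "A \<in> carrier_mat n m \<Longrightarrow> v \<in> carrier_vec m \<Longrightarrow> A * rank_one v w = rank_one (A *\<^sub>v v) w"
  by (intro eq_matI) (auto simp: scalar_prod_def sum_distrib_left sum_distrib_right ac_simps)

lemma rank_one_mult_vec:
  "w \<in> carrier_vec m \<Longrightarrow> x \<in> carrier_vec m \<Longrightarrow> rank_one v w *\<^sub>v x = (x \<bullet>c w) \<cdot>\<^sub>v v"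
  by (intro eq_vecI) (auto simp: scalar_prod_def sum_distrib_left sum_distrib_right ac_simps)

lemma mat_adjoint_rank_one [simp]: "mat_adjoint (rank_one v w) = rank_one w v"
  by (intro eq_matI) (auto simp: ac_simps)

lemma rank_one_smult: "rank_one (c \<cdot>\<^sub>v v) w = c \<cdot>\<^sub>m rank_one v w"
  by (intro eq_matI) auto

lemma trace_rank_one: "v \<in> carrier_vec n \<Longrightarrow> w \<in> carrier_vec n \<Longrightarrow> trace (rank_one v w) = v \<bullet>c w"
  by (auto simp: trace_def scalar_prod_def atLeast0LessThan)

lemma mat_eq_if_mult_vec_eq:
  fixes A :: "complex mat"
  assumes "A \<in> carrier_mat n m" "B \<in> carrier_mat n m"
    and eq: "\<And>v. v \<in> carrier_vec m \<Longrightarrow> A *\<^sub>v v = B *\<^sub>v v"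
  shows "A = B"
proof (rule eq_matI)
  fix i j assume "i < dim_row B" "j < dim_col B"
  then show "A $$ (i, j) = B $$ (i, j)"
    using assms(1,2) arg_cong[OF eq[of "unit_vec m j"], of "\<lambda>v. v $ i"] by auto
qed (use assms in auto)

text \<open>Truncating a vector after its first \<open>k\<close> coordinates reduces linearity over finite sums to an
  induction on \<open>k\<close>.\<close>

lemma linear_map_matrix:
  fixes T :: "complex vec \<Rightarrow> complex vec"
  assumes closed: "\<And>x. x \<in> carrier_vec n \<Longrightarrow> T x \<in> carrier_vec d"
    and add: "\<And>x y. x \<in> carrier_vec n \<Longrightarrow> y \<in> carrier_vec n \<Longrightarrow> T (x + y) = T x + T y"
    and smult: "\<And>c x. x \<in> carrier_vec n \<Longrightarrow> T (c \<cdot>\<^sub>v x) = c \<cdot>\<^sub>v T x"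
  shows "\<exists>W\<in>carrier_mat d n. \<forall>x\<in>carrier_vec n. T x = W *\<^sub>v x"
proof (intro bexI ballI)
  let ?W = "mat d n (\<lambda>(i, j). T (unit_vec n j) $ i)"
  show W: "?W \<in> carrier_mat d n" by simp
  fix x :: "complex vec" assume x: "x \<in> carrier_vec n"
  define t where "t k = vec n (\<lambda>j. if j < k then x $ j else 0)" for k
  have t: "t k \<in> carrier_vec n" for k by (simp add: t_def)
  have "T (t k) = ?W *\<^sub>v t k" if "k \<le> n" for k
    using that
  proof (induction k)
    case 0
    have "t 0 = 0 \<cdot>\<^sub>v 0\<^sub>v n" by (rule eq_vecI) (auto simp: t_def)
    moreover have "T (0 \<cdot>\<^sub>v 0\<^sub>v n) = 0 \<cdot>\<^sub>v T (0\<^sub>v n)" by (rule smult) simp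
    moreover have "0 \<cdot>\<^sub>v T (0\<^sub>v n) = 0\<^sub>v d" using closed[of "0\<^sub>v n"] by (intro eq_vecI) auto
    ultimately show ?case by auto
  next
    case (Suc k)
    have t_Suc: "t (Suc k) = t k + x $ k \<cdot>\<^sub>v unit_vec n k"
      by (rule eq_vecI) (auto simp: t_def less_Suc_eq unit_vec_def)
    have "T (unit_vec n k) = ?W *\<^sub>v unit_vec n k"
      using Suc.prems closed[of "unit_vec n k"] by (intro eq_vecI) auto
    then show ?case
      using Suc t[of k] unfolding t_Suc
      by (simp add: add smult mult_add_distrib_mat_vec[OF W] mult_mat_vec[OF W])
  qed
  from this[of n] have "T (t n) = ?W *\<^sub>v t n" by simp
  moreover have "t n = x" using x by (intro eq_vecI) (auto simp: t_def)
  ultimately show "T x = ?W *\<^sub>v x" by simp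
qed

lemma rank_one_mult_rank_one:
  assumes "w \<in> carrier_vec n" "x \<in> carrier_vec n"
  shows "rank_one v w * rank_one x y = (x \<bullet>c w) \<cdot>\<^sub>m rank_one v y"
proof -
  have "rank_one v w \<in> carrier_mat (dim_vec v) n"
    by (rule carrier_matI) (use assms in simp_all)
  then show ?thesis
    using assms by (simp add: mult_rank_one[of _ "dim_vec v" n] rank_one_mult_vec[where m = n] rank_one_smult)
qed

lemma rank_one_add:
  "v \<in> carrier_vec n \<Longrightarrow> w \<in> carrier_vec n \<Longrightarrow> rank_one (v + w) x = rank_one v x + rank_one w x"
  by (intro eq_matI) (auto simp: algebra_simps)

lemma mat_eq_if_inner_eq:
  fixes A :: "complex mat"
  assumes "A \<in> carrier_mat n m" "B \<in> carrier_mat n m"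
    and eq: "\<And>x y. x \<in> carrier_vec m \<Longrightarrow> y \<in> carrier_vec n \<Longrightarrow> (A *\<^sub>v x) \<bullet>c y = (B *\<^sub>v x) \<bullet>c y"
  shows "A = B"
proof (rule mat_eq_if_mult_vec_eq[OF assms(1,2)])
  fix x :: "complex vec" assume x: "x \<in> carrier_vec m"
  have c: "A *\<^sub>v x \<in> carrier_vec n" "B *\<^sub>v x \<in> carrier_vec n"
    using assms x by auto
  have unit: "v \<bullet>c unit_vec n k = v $ k" if "v \<in> carrier_vec n" "k < n" for v :: "complex vec" and k
  proof -
    have "conjugate (unit_vec n k :: complex vec) = unit_vec n k"
      by (rule eq_vecI) (auto simp: unit_vec_def)
    then show ?thesis using that by simp
  qed
  show "A *\<^sub>v x = B *\<^sub>v x"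
  proof (rule eq_vecI)
    fix k assume "k < dim_vec (B *\<^sub>v x)"
    then have k: "k < n" using assms(2) by simp
    show "(A *\<^sub>v x) $ k = (B *\<^sub>v x) $ k"
      using eq[OF x, of "unit_vec n k"] unit[OF c(1) k] unit[OF c(2) k] by simp
  qed (use assms(1,2) in simp)
qed

lemma smult_one_mat:
  "(1 :: complex) \<cdot>\<^sub>m A = A" "(0 :: complex) \<cdot>\<^sub>m 1\<^sub>m n = 0\<^sub>m n n"
  by (auto intro!: eq_matI)

lemma inner_unit_vec:
  "i < n \<Longrightarrow> (unit_vec n i \<bullet>c unit_vec n i :: complex) = 1"
  by (simp add: scalar_prod_def unit_vec_def if_distrib sum.delta cong: if_cong)

lemma smult_mat_mult_vec:
  fixes A :: "complex mat"
  assumes "A \<in> carrier_mat n m" "v \<in> carrier_vec m"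
  shows "(c \<cdot>\<^sub>m A) *\<^sub>v v = c \<cdot>\<^sub>v (A *\<^sub>v v)"
  using assms by (intro eq_vecI) (simp_all add: scalar_prod_def sum_distrib_left mult.assoc)

section \<open>Orthogonal projections\<close>

text \<open>A projection equals \<open>p p\<^sup>*\<close>, whose trace is a sum of squares; so traces of projections are
  nonnegative.\<close>

lemma trace_projection:
  assumes "p \<in> carrier_mat d d" "p * p = p" "mat_adjoint p = p"
  shows "trace p = of_real (\<Sum>i<d. \<Sum>j<d. (cmod (p $$ (i, j)))\<^sup>2)"
proof -
  have "trace p = trace (p * mat_adjoint p)" using assms by simp
  also have "\<dots> = (\<Sum>i<d. \<Sum>j<d. p $$ (i, j) * cnj (p $$ (i, j)))"
    using assms(1)
    by (auto simp: trace_def scalar_prod_def atLeast0LessThan intro!: sum.cong)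
  also have "\<dots> = of_real (\<Sum>i<d. \<Sum>j<d. (cmod (p $$ (i, j)))\<^sup>2)"
    by (simp only: of_real_sum complex_norm_square)
  finally show ?thesis .
qed

text \<open>A nonzero projection fixes some unit vector \<open>f\<close>, and \<open>p - f f\<^sup>*\<close> is again a projection,
  of trace one less; as traces of projections are nonnegative, this stops after finitely many steps
  and shows on the way that the trace of a projection counts the dimension of its range.\<close>

lemma projection_orthonormal_basis:
  assumes "p \<in> carrier_mat d d" "p * p = p" "mat_adjoint p = p"
  shows "\<exists>fs. trace p = of_nat (length fs) \<and> (\<forall>f\<in>set fs. f \<in> carrier_vec d \<and> p *\<^sub>v f = f) \<and>
    (\<forall>i<length fs. \<forall>j<length fs. fs ! i \<bullet>c fs ! j = (if i = j then 1 else 0))"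
  using assms
proof (induction "nat \<lfloor>Re (trace p)\<rfloor>" arbitrary: p rule: less_induct)
  case less
  note p = less.prems
  show ?case
  proof (cases "p = 0\<^sub>m d d")
    case True
    then show ?thesis by (intro exI[of _ "[]"]) auto
  next
    case False
    then obtain x where x: "x \<in> carrier_vec d" "p *\<^sub>v x \<noteq> 0\<^sub>v d"
      using mat_eq_if_mult_vec_eq[OF p(1), of "0\<^sub>m d d"] by fastforce
    define y where "y = p *\<^sub>v x"
    have y: "y \<in> carrier_vec d" "p *\<^sub>v y = y"
      using p x unfolding y_def by (auto simp flip: assoc_mult_mat_vec)
    define s where "s = complex_of_real (1 / sqrt (Re (y \<bullet>c y)))"
    have yy: "y \<bullet>c y > 0"
      using x(2) y(1) unfolding y_def[symmetric] by simp
    then have yy': "y \<bullet>c y = of_real (Re (y \<bullet>c y))" "Re (y \<bullet>c y) > 0"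
      by (auto simp: less_complex_def complex_eq_iff)
    define f where "f = s \<cdot>\<^sub>v y"
    have f: "f \<in> carrier_vec d" "p *\<^sub>v f = f"
      using y p by (auto simp: f_def mult_mat_vec)
    have ff: "f \<bullet>c f = 1"
    proof -
      have "f \<bullet>c f = s * cnj s * (y \<bullet>c y)"
        using y by (simp add: f_def conjugate_smult_vec)
      also have "\<dots> = of_real (1 / sqrt (Re (y \<bullet>c y)) * (1 / sqrt (Re (y \<bullet>c y))) * Re (y \<bullet>c y))"
        using yy' unfolding s_def by (metis complex_cnj_complex_of_real of_real_mult)
      also have "\<dots> = 1" using yy'(2) by (simp add: field_simps)
      finally show ?thesis .
    qed
    define q where "q = rank_one f f"
    have q: "q \<in> carrier_mat d d" "mat_adjoint q = q" "p * q = q" "q * q = q" "trace q = 1"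
      using f p ff
      by (auto simp: q_def mult_rank_one[where m = d and n = d] rank_one_mult_vec[where m = d] trace_rank_one)
    have qp: "q * p = q"
      using mat_adjoint_mult[OF p(1) q(1)] p q by simp
    \<comment> \<open>The part of the projection orthogonal to \<open>f\<close>.\<close>
    define r where "r = p + (-1) \<cdot>\<^sub>m q"
    have r: "r \<in> carrier_mat d d" using p q by (auto simp: r_def)
    have radj: "mat_adjoint r = r"
      using p q by (auto simp: r_def mat_adjoint_add[where n = d and m = d] mat_adjoint_smult)
    have pr: "p * r = r"
      using p q by (simp add: r_def mult_add_distrib_mat[where n = d and nr = d and nc = d]
          mult_smult_distrib[where n = d and nr = d and nc = d])
    have qr: "q * r = 0\<^sub>m d d"
      using p q qp by (auto simp: r_def mult_add_distrib_mat[where n = d and nr = d and nc = d]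
          mult_smult_distrib[where n = d and nr = d and nc = d])
    have rr: "r * r = r"
    proof -
      have "r * r = p * r + ((-1) \<cdot>\<^sub>m q) * r"
        using p q r by (subst (1) r_def) (auto intro!: add_mult_distrib_mat)
      also have "((-1) \<cdot>\<^sub>m q) * r = 0\<^sub>m d d"
        using q r qr by (simp add: mult_smult_assoc_mat[where n = d and nr = d and nc = d])
      finally show ?thesis using pr r by simp
    qed
    have tr: "trace p = trace r + 1"
      using p q by (simp add: r_def trace_add[where n = d] trace_smult[where n = d])
    have "Re (trace r) \<ge> 0"
      by (subst trace_projection[OF r rr radj]) (simp add: sum_nonneg)
    then have "nat \<lfloor>Re (trace r)\<rfloor> < nat \<lfloor>Re (trace p)\<rfloor>"
      using tr by simp
    from less.hyps[OF this r rr radj] obtain fs where fs: "trace r = of_nat (length fs)"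
      "\<And>g. g \<in> set fs \<Longrightarrow> g \<in> carrier_vec d \<and> r *\<^sub>v g = g"
      "\<And>i j. i < length fs \<Longrightarrow> j < length fs \<Longrightarrow> fs ! i \<bullet>c fs ! j = (if i = j then 1 else 0)"
      by blast
    have fixed: "p *\<^sub>v g = g" if "g \<in> set fs" for g
      using fs(2)[OF that] pr p r by (metis assoc_mult_mat_vec)
    have orth: "g \<bullet>c f = 0" "f \<bullet>c g = 0" if "g \<in> set fs" for g
    proof -
      have g: "g \<in> carrier_vec d" "r *\<^sub>v g = g" using fs(2)[OF that] by auto
      have "q *\<^sub>v g = 0\<^sub>v d"
        using arg_cong[OF qr, of "\<lambda>M. M *\<^sub>v g"] g q r by (auto simp: assoc_mult_mat_vec[where n\<^sub>2 = d])
      then have "(g \<bullet>c f) \<cdot>\<^sub>v f = 0\<^sub>v d"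
        using g f by (simp add: q_def rank_one_mult_vec[where m = d])
      then have "((g \<bullet>c f) \<cdot>\<^sub>v f) \<bullet>c f = 0" using f by simp
      then show *: "g \<bullet>c f = 0" using f ff by simp
      have "f \<bullet>c g = conjugate (g \<bullet>c f)"
        using f g by (metis conjugate_conjugate_sprod conjugate_vec_sprod_comm)
      then show "f \<bullet>c g = 0" using * by simp
    qed
    show ?thesis
    proof (intro exI[of _ "f # fs"] conjI ballI allI impI)
      fix i j assume "i < length (f # fs)" "j < length (f # fs)"
      then show "(f # fs) ! i \<bullet>c (f # fs) ! j = (if i = j then 1 else 0)"
        using fs(3) ff orth by (cases i; cases j) auto
    qed (use fs tr f fixed in auto)
  qed
qed


section \<open>Tuples of matrices\<close>

lemma matrix_tuplesD:
  "a \<in> matrix_tuples ns \<Longrightarrow> length a = length ns"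
  "a \<in> matrix_tuples ns \<Longrightarrow> j < length ns \<Longrightarrow> a ! j \<in> carrier_mat (ns ! j) (ns ! j)"
  by (auto simp: matrix_tuples_def)

lemma matrix_tuples_eqI:
  "a \<in> matrix_tuples ns \<Longrightarrow> b \<in> matrix_tuples ns \<Longrightarrow> (\<And>j. j < length ns \<Longrightarrow> a ! j = b ! j) \<Longrightarrow> a = b"
  by (rule nth_equalityI) (auto simp: matrix_tuples_def)

lemma matrix_tuples_closed [simp]:
  "map 1\<^sub>m ns \<in> matrix_tuples ns"
  "map (\<lambda>k. 0\<^sub>m k k) ns \<in> matrix_tuples ns"
  "a \<in> matrix_tuples ns \<Longrightarrow> b \<in> matrix_tuples ns \<Longrightarrow> map2 (+) a b \<in> matrix_tuples ns"
  "a \<in> matrix_tuples ns \<Longrightarrow> b \<in> matrix_tuples ns \<Longrightarrow> map2 (*) a b \<in> matrix_tuples ns"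
  "a \<in> matrix_tuples ns \<Longrightarrow> map ((\<cdot>\<^sub>m) c) a \<in> matrix_tuples ns"
  "a \<in> matrix_tuples ns \<Longrightarrow> map mat_adjoint a \<in> matrix_tuples ns"
  by (auto simp: matrix_tuples_def)

definition at_block :: "nat list \<Rightarrow> nat \<Rightarrow> complex mat \<Rightarrow> complex mat list" where
  "at_block ns i x = map (\<lambda>j. if j = i then x else 0\<^sub>m (ns ! j) (ns ! j)) [0..<length ns]"

abbreviation matrix_unit :: "nat list \<Rightarrow> nat \<Rightarrow> nat \<Rightarrow> nat \<Rightarrow> complex mat list" where
  "matrix_unit ns i k l \<equiv> at_block ns i (rank_one (unit_vec (ns ! i) k) (unit_vec (ns ! i) l))"

lemma at_block_closed [simp]:
  "x \<in> carrier_mat (ns ! i) (ns ! i) \<Longrightarrow> at_block ns i x \<in> matrix_tuples ns"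
  by (auto simp: matrix_tuples_def at_block_def)

lemma nth_at_block [simp]:
  "j < length ns \<Longrightarrow> at_block ns i x ! j = (if j = i then x else 0\<^sub>m (ns ! j) (ns ! j))"
  by (simp add: at_block_def)

lemma length_at_block [simp]: "length (at_block ns i x) = length ns"
  by (simp add: at_block_def)

lemma mult_at_block:
  assumes "a \<in> matrix_tuples ns" "x \<in> carrier_mat (ns ! i) (ns ! i)"
  shows "map2 (*) a (at_block ns i x) = at_block ns i (a ! i * x)"
  using assms
  by (intro nth_equalityI) (auto simp: matrix_tuplesD right_mult_zero_mat[OF matrix_tuplesD(2)])

lemma at_block_mult_at_block:
  assumes "x \<in> carrier_mat (ns ! i) (ns ! i)" "y \<in> carrier_mat (ns ! j) (ns ! j)"
    "i < length ns" "j < length ns"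
  shows "map2 (*) (at_block ns i x) (at_block ns j y) =
    (if i = j then at_block ns i (x * y) else map (\<lambda>k. 0\<^sub>m k k) ns)"
  using assms by (intro nth_equalityI) auto

lemma at_block_add:
  assumes "x \<in> carrier_mat (ns ! i) (ns ! i)" "y \<in> carrier_mat (ns ! i) (ns ! i)"
  shows "at_block ns i (x + y) = map2 (+) (at_block ns i x) (at_block ns i y)"
  using assms by (intro nth_equalityI) auto

lemma at_block_smult:
  assumes "x \<in> carrier_mat (ns ! i) (ns ! i)"
  shows "at_block ns i (c \<cdot>\<^sub>m x) = map ((\<cdot>\<^sub>m) c) (at_block ns i x)"
  using assms by (intro nth_equalityI) auto

lemma at_block_adjoint:
  assumes "x \<in> carrier_mat (ns ! i) (ns ! i)"
  shows "map mat_adjoint (at_block ns i x) = at_block ns i (mat_adjoint x)"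
  using assms by (intro nth_equalityI) auto

text \<open>Induction over linear combinations of matrix units. It proves linear identities by checking
  them on matrix units, and it also gives the finite dimension of the algebra.\<close>

lemma matrix_tuples_span [consumes 1, case_names zero add smult unit]:
  assumes a: "a \<in> matrix_tuples ns"
    and zero: "P (map (\<lambda>k. 0\<^sub>m k k) ns)"
    and add: "\<And>a b. a \<in> matrix_tuples ns \<Longrightarrow> b \<in> matrix_tuples ns \<Longrightarrow> P a \<Longrightarrow> P b \<Longrightarrow> P (map2 (+) a b)"
    and smult: "\<And>c a. a \<in> matrix_tuples ns \<Longrightarrow> P a \<Longrightarrow> P (map ((\<cdot>\<^sub>m) c) a)"
    and unit: "\<And>i k l. i < length ns \<Longrightarrow> k < ns ! i \<Longrightarrow> l < ns ! i \<Longrightarrow> P (matrix_unit ns i k l)"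
  shows "P a"
proof -
  define K where "K = Sigma {..<length ns} (\<lambda>i. {..<ns ! i} \<times> {..<ns ! i})"
  \<comment> \<open>The tuple \<open>a\<close> with all entries outside \<open>S\<close> set to zero; \<open>S\<close> grows by one entry at a time.\<close>
  define mask where "mask S = map (\<lambda>j. mat (ns ! j) (ns ! j)
    (\<lambda>(k, l). if (j, k, l) \<in> S then a ! j $$ (k, l) else 0)) [0..<length ns]" for S
  have nth_mask: "mask S ! j = mat (ns ! j) (ns ! j) (\<lambda>(k, l). if (j, k, l) \<in> S then a ! j $$ (k, l) else 0)"
    if "j < length ns" for S j
    using that by (simp add: mask_def cong: if_cong)
  have mask: "mask S \<in> matrix_tuples ns" for S
    by (simp add: matrix_tuples_def nth_mask) (simp add: mask_def)
  have "P (mask S)" if "finite S" "S \<subseteq> K" for S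
    using that
  proof (induction S rule: finite_induct)
    case empty
    have "mask {} = map (\<lambda>k. 0\<^sub>m k k) ns"
      by (rule matrix_tuples_eqI[OF mask]) (auto simp: nth_mask)
    then show ?case using zero by simp
  next
    case (insert x S)
    obtain i k l where x: "x = (i, k, l)" by (cases x)
    have b: "i < length ns" "k < ns ! i" "l < ns ! i" using insert.prems x by (auto simp: K_def)
    let ?E = "map ((\<cdot>\<^sub>m) (a ! i $$ (k, l))) (matrix_unit ns i k l)"
    have E: "?E \<in> matrix_tuples ns" by simp
    have "mask (insert x S) = map2 (+) ?E (mask S)"
    proof (rule matrix_tuples_eqI[OF mask])
      show "map2 (+) ?E (mask S) \<in> matrix_tuples ns" using E mask by simp
      fix j assume j: "j < length ns"
      then have "map2 (+) ?E (mask S) ! j = ?E ! j + mask S ! j"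
        using matrix_tuplesD(1)[OF mask] by simp
      also have "\<dots> = mask (insert x S) ! j"
        using j b insert.hyps(2) by (intro eq_matI) (auto simp: nth_mask x unit_vec_def)
      finally show "mask (insert x S) ! j = map2 (+) ?E (mask S) ! j" ..
    qed
    then show ?case
      using insert E b mask by (simp add: add smult unit)
  qed
  from this[of K] have "P (mask K)" by (simp add: K_def)
  also have "mask K = a"
  proof (rule matrix_tuples_eqI[OF mask a])
    fix j assume j: "j < length ns"
    then show "mask K ! j = a ! j"
      using matrix_tuplesD(2)[OF a j] by (intro eq_matI) (auto simp: nth_mask K_def)
  qed
  finally show ?thesis .
qed

section \<open>Block diagonal sums of the entries of a tuple\<close>

text \<open>This is the operator \<open>\<Oplus>\<^sub>i 1 \<otimes> a\<^sub>i\<close>, with \<open>1\<close> the identity of size \<open>c\<^sub>i\<close>. It is both the matrix of the standard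
  action with multiplicities \<open>c\<close> and a component of the block embedding of a diagram with column \<open>c\<close>.\<close>

definition multiplicity_sum :: "nat list \<Rightarrow> complex mat list \<Rightarrow> complex mat" where
  "multiplicity_sum cs as = diag_block_mat (concat (map2 replicate cs as))"

text \<open>The same operator described by the list of the block indices in their order along the diagonal,
  which is the form suited to induction.\<close>

definition block_sum :: "nat list \<Rightarrow> complex mat list \<Rightarrow> complex mat" where
  "block_sum ts as = diag_block_mat (map ((!) as) ts)"

definition block_order :: "nat list \<Rightarrow> nat list" where
  "block_order cs = concat (map (\<lambda>i. replicate (cs ! i) i) [0..<length cs])"

lemma multiplicity_sum_eq:
  assumes "length cs = length as"
  shows "multiplicity_sum cs as = block_sum (block_order cs) as"
proof -
  have "map2 replicate cs as = map (\<lambda>i. replicate (cs ! i) (as ! i)) [0..<length cs]"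
    using assms by (intro nth_equalityI) auto
  then show ?thesis
    by (simp add: multiplicity_sum_def block_sum_def block_order_def map_concat o_def)
qed

lemma set_block_order: "set (block_order cs) = {i. i < length cs \<and> 0 < cs ! i}"
  by (auto simp: block_order_def set_replicate_conv_if split: if_splits)

lemma sum_list_block_order:
  fixes f :: "nat \<Rightarrow> 'a :: comm_semiring_1"
  shows "(\<Sum>i\<leftarrow>block_order cs. f i) = (\<Sum>i<length cs. of_nat (cs ! i) * f i)"
proof -
  have "(\<Sum>i\<leftarrow>concat (map (\<lambda>i. replicate (cs ! i) i) is). f i) = (\<Sum>i\<leftarrow>is. of_nat (cs ! i) * f i)" for "is"
    by (induction "is") (auto simp: sum_list_replicate)
  then show ?thesis
    by (simp add: block_order_def sum_list_distinct_conv_sum_set atLeast0LessThan)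
qed

lemma block_sum_Nil [simp]: "block_sum [] as = 0\<^sub>m 0 0"
  by (simp add: block_sum_def)

lemma block_sum_carrier:
  assumes "set ts \<subseteq> {..<length ns}" "a \<in> matrix_tuples ns"
  shows "block_sum ts a \<in> carrier_mat (\<Sum>i\<leftarrow>ts. ns ! i) (\<Sum>i\<leftarrow>ts. ns ! i)"
proof -
  have d: "dim_row (a ! i) = ns ! i" "dim_col (a ! i) = ns ! i" if "i \<in> set ts" for i
    using matrix_tuplesD(2)[OF assms(2), of i] assms(1) that by auto
  show ?thesis
    by (rule carrier_matI) (simp_all add: block_sum_def dim_diag_block_mat o_def d cong: map_cong)
qed

lemma block_sum_Cons:
  assumes "set (i # ts) \<subseteq> {..<length ns}" "a \<in> matrix_tuples ns"
  shows "block_sum (i # ts) a = four_block_mat (a ! i)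
    (0\<^sub>m (ns ! i) (\<Sum>i\<leftarrow>ts. ns ! i)) (0\<^sub>m (\<Sum>i\<leftarrow>ts. ns ! i) (ns ! i)) (block_sum ts a)"
proof -
  have "block_sum ts a \<in> carrier_mat (\<Sum>i\<leftarrow>ts. ns ! i) (\<Sum>i\<leftarrow>ts. ns ! i)" "a ! i \<in> carrier_mat (ns ! i) (ns ! i)"
    using assms block_sum_carrier[of ts ns a] matrix_tuplesD(2)[OF assms(2), of i] by simp_all
  then show ?thesis by (simp add: block_sum_def Let_def)
qed

lemma trace_four_block:
  assumes "A \<in> carrier_mat n n" "D \<in> carrier_mat m m"
  shows "trace (four_block_mat A B C D) = trace A + trace D"
proof -
  have split: "(\<Sum>i<n + m. f i) = (\<Sum>i<n. f i) + (\<Sum>i<m. f (n + i))" for f :: "nat \<Rightarrow> complex"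
    by (induction m) (auto simp: add.assoc)
  show ?thesis
    using assms by (simp add: trace_def split)
qed

text \<open>Block diagonal matrices are added, multiplied and adjoined block by block; all parts share one
  induction along the diagonal.\<close>

lemma block_sum_hom:
  assumes "set ts \<subseteq> {..<length ns}" and a: "a \<in> matrix_tuples ns" and b: "b \<in> matrix_tuples ns"
  shows "block_sum ts (map2 (+) a b) = block_sum ts a + block_sum ts b"
    and "block_sum ts (map2 (*) a b) = block_sum ts a * block_sum ts b"
    and "block_sum ts (map ((\<cdot>\<^sub>m) c) a) = c \<cdot>\<^sub>m block_sum ts a"
    and "block_sum ts (map mat_adjoint a) = mat_adjoint (block_sum ts a)"
    and "block_sum ts (map 1\<^sub>m ns) = 1\<^sub>m (\<Sum>i\<leftarrow>ts. ns ! i)"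
    and "trace (block_sum ts a) = (\<Sum>i\<leftarrow>ts. trace (a ! i))"
proof -
  let ?s = "\<lambda>ts. \<Sum>i\<leftarrow>ts. ns ! i"
  have "block_sum ts (map2 (+) a b) = block_sum ts a + block_sum ts b \<and>
    block_sum ts (map2 (*) a b) = block_sum ts a * block_sum ts b \<and>
    block_sum ts (map ((\<cdot>\<^sub>m) c) a) = c \<cdot>\<^sub>m block_sum ts a \<and>
    block_sum ts (map mat_adjoint a) = mat_adjoint (block_sum ts a) \<and>
    block_sum ts (map 1\<^sub>m ns) = 1\<^sub>m (?s ts) \<and>
    trace (block_sum ts a) = (\<Sum>i\<leftarrow>ts. trace (a ! i))"
    using assms(1)
  proof (induction ts)
    case Nil
    show ?case by (intro conjI eq_matI) (simp_all add: trace_def)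
  next
    case (Cons i ts)
    have i: "i < length ns" "i < length a" "i < length b" and ts: "set ts \<subseteq> {..<length ns}"
      using Cons.prems matrix_tuplesD(1)[OF a] matrix_tuplesD(1)[OF b] by simp_all
    note IH = Cons.IH[OF ts]
    have c: "a ! i \<in> carrier_mat (ns ! i) (ns ! i)" "b ! i \<in> carrier_mat (ns ! i) (ns ! i)"
      "block_sum ts a \<in> carrier_mat (?s ts) (?s ts)" "block_sum ts b \<in> carrier_mat (?s ts) (?s ts)"
      using matrix_tuplesD(2)[OF a i(1)] matrix_tuplesD(2)[OF b i(1)]
        block_sum_carrier[OF ts a] block_sum_carrier[OF ts b] by simp_all
    note eq = block_sum_Cons[OF Cons.prems]
    have 1: "trace (block_sum (i # ts) a) = (\<Sum>i\<leftarrow>i # ts. trace (a ! i))"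
      using IH c by (simp add: eq[OF a] trace_four_block[where n = "ns ! i" and m = "?s ts"])
    have 2: "block_sum (i # ts) (map2 (*) a b) = block_sum (i # ts) a * block_sum (i # ts) b"
      using a b c i IH by (simp add: eq mult_four_block_mat[where ?n1.0 = "ns ! i" and ?n2.0 = "?s ts"
            and ?nr1.0 = "ns ! i" and ?nr2.0 = "?s ts" and ?nc1.0 = "ns ! i" and ?nc2.0 = "?s ts"])
    have 3: "block_sum (i # ts) (map2 (+) a b) = block_sum (i # ts) a + block_sum (i # ts) b"
      using a b c i IH by (simp add: eq add_four_block_mat[where
            ?nr1.0 = "ns ! i" and ?nr2.0 = "?s ts" and ?nc1.0 = "ns ! i" and ?nc2.0 = "?s ts"])
    have 4: "block_sum (i # ts) (map ((\<cdot>\<^sub>m) c) a) = c \<cdot>\<^sub>m block_sum (i # ts) a"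
      using a c i IH by (simp add: eq smult_four_block_mat[where ?nr1.0 = "ns ! i"
            and ?nr2.0 = "?s ts" and ?nc1.0 = "ns ! i" and ?nc2.0 = "?s ts"])
    have 5: "block_sum (i # ts) (map mat_adjoint a) = mat_adjoint (block_sum (i # ts) a)"
      using a c i IH by (simp add: eq mat_adjoint_four_block[where n = "ns ! i" and m = "ns ! i"
            and k = "?s ts" and p = "?s ts"])
    have 6: "block_sum (i # ts) (map 1\<^sub>m ns) = 1\<^sub>m (?s (i # ts))"
      using i IH by (simp add: eq)
    show ?case using 1 2 3 4 5 6 by blast
  qed
  then show "block_sum ts (map2 (+) a b) = block_sum ts a + block_sum ts b"
    "block_sum ts (map2 (*) a b) = block_sum ts a * block_sum ts b"
    "block_sum ts (map ((\<cdot>\<^sub>m) c) a) = c \<cdot>\<^sub>m block_sum ts a"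
    "block_sum ts (map mat_adjoint a) = mat_adjoint (block_sum ts a)"
    "block_sum ts (map 1\<^sub>m ns) = 1\<^sub>m (?s ts)"
    "trace (block_sum ts a) = (\<Sum>i\<leftarrow>ts. trace (a ! i))"
    by blast+
qed

lemma block_sum_inj:
  assumes "set ts \<subseteq> {..<length ns}" "a \<in> matrix_tuples ns" "b \<in> matrix_tuples ns"
    "block_sum ts a = block_sum ts b" "i \<in> set ts"
  shows "a ! i = b ! i"
  using assms(1,4,5)
proof (induction ts)
  case (Cons k ts)
  let ?s = "\<Sum>i\<leftarrow>ts. ns ! i"
  have k: "k < length ns" and ts: "set ts \<subseteq> {..<length ns}" using Cons.prems by auto
  have c: "a ! k \<in> carrier_mat (ns ! k) (ns ! k)" "b ! k \<in> carrier_mat (ns ! k) (ns ! k)"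
    "block_sum ts a \<in> carrier_mat ?s ?s" "block_sum ts b \<in> carrier_mat ?s ?s"
    using matrix_tuplesD(2)[OF assms(2) k] matrix_tuplesD(2)[OF assms(3) k]
      block_sum_carrier[OF ts assms(2)] block_sum_carrier[OF ts assms(3)] by simp_all
  have e: "four_block_mat (a ! k) (0\<^sub>m (ns ! k) ?s) (0\<^sub>m ?s (ns ! k)) (block_sum ts a) $$ (x, y) =
    four_block_mat (b ! k) (0\<^sub>m (ns ! k) ?s) (0\<^sub>m ?s (ns ! k)) (block_sum ts b) $$ (x, y)" for x y
    using Cons.prems(2) by (simp add: block_sum_Cons[OF Cons.prems(1)] assms(2,3))
  have "a ! k = b ! k"
  proof (rule eq_matI)
    fix x y assume "x < dim_row (b ! k)" "y < dim_col (b ! k)"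
    then show "a ! k $$ (x, y) = b ! k $$ (x, y)" using e[of x y] c[THEN carrier_matD(1)] c[THEN carrier_matD(2)] by simp
  qed (use c[THEN carrier_matD(1)] c[THEN carrier_matD(2)] in simp_all)
  moreover have "block_sum ts a = block_sum ts b"
  proof (rule eq_matI)
    fix x y assume "x < dim_row (block_sum ts b)" "y < dim_col (block_sum ts b)"
    then show "block_sum ts a $$ (x, y) = block_sum ts b $$ (x, y)"
      using e[of "ns ! k + x" "ns ! k + y"] c[THEN carrier_matD(1)] c[THEN carrier_matD(2)] by simp
  qed (use c[THEN carrier_matD(1)] c[THEN carrier_matD(2)] in simp_all)
  ultimately show ?case using Cons.IH[OF ts] Cons.prems(3) by auto
qed simp


section \<open>Matrices built from columns\<close>

text \<open>A block row is a block matrix whose lower blocks have no rows, so the multiplication rules of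
  four-block matrices apply to it.\<close>

definition beside :: "complex mat \<Rightarrow> complex mat \<Rightarrow> complex mat" where
  "beside W H = four_block_mat W H (0\<^sub>m 0 (dim_col W)) (0\<^sub>m 0 (dim_col H))"

lemma beside_carrier:
  "W \<in> carrier_mat d n \<Longrightarrow> H \<in> carrier_mat d m \<Longrightarrow> beside W H \<in> carrier_mat d (n + m)"
  unfolding beside_def by (rule carrier_matI) simp_all

lemma mult_beside:
  assumes "M \<in> carrier_mat k d" "W \<in> carrier_mat d n" "H \<in> carrier_mat d m"
  shows "M * beside W H = beside (M * W) (M * H)"
proof -
  have "M = four_block_mat M (0\<^sub>m k 0) (0\<^sub>m 0 d) (0\<^sub>m 0 0)"
    using assms by (intro eq_matI) auto
  then have "M * beside W H = four_block_mat M (0\<^sub>m k 0) (0\<^sub>m 0 d) (0\<^sub>m 0 0) *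
      four_block_mat W H (0\<^sub>m 0 n) (0\<^sub>m 0 m)"
    using assms by (simp add: beside_def)
  also have "\<dots> = beside (M * W) (M * H)"
    using assms by (subst mult_four_block_mat[where ?nr1.0 = k and ?n1.0 = d and ?n2.0 = 0
          and ?nr2.0 = 0 and ?nc1.0 = n and ?nc2.0 = m]) (auto simp: beside_def)
  finally show ?thesis .
qed

lemma beside_mult_diag:
  assumes "W \<in> carrier_mat d n" "H \<in> carrier_mat d m" "A \<in> carrier_mat n n" "B \<in> carrier_mat m m"
  shows "beside W H * four_block_mat A (0\<^sub>m n m) (0\<^sub>m m n) B = beside (W * A) (H * B)"
  using assms unfolding beside_def
  by (subst mult_four_block_mat[where ?nr1.0 = d and ?n1.0 = n and ?n2.0 = m
        and ?nr2.0 = 0 and ?nc1.0 = n and ?nc2.0 = m]) auto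

lemma beside_gram:
  assumes "W \<in> carrier_mat d n" "H \<in> carrier_mat d m"
  shows "mat_adjoint (beside W H) * beside W H =
    four_block_mat (mat_adjoint W * W) (mat_adjoint W * H) (mat_adjoint H * W) (mat_adjoint H * H)"
proof -
  have "mat_adjoint (beside W H) =
      four_block_mat (mat_adjoint W) (0\<^sub>m n 0) (mat_adjoint H) (0\<^sub>m m 0)"
    using assms unfolding beside_def
    by (subst mat_adjoint_four_block[where n = d and m = n and k = m and p = 0]) auto
  moreover have "beside W H = four_block_mat W H (0\<^sub>m 0 n) (0\<^sub>m 0 m)"
    using assms by (simp add: beside_def)
  moreover have "four_block_mat (mat_adjoint W) (0\<^sub>m n 0) (mat_adjoint H) (0\<^sub>m m 0) *
      four_block_mat W H (0\<^sub>m 0 n) (0\<^sub>m 0 m) =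
    four_block_mat (mat_adjoint W * W) (mat_adjoint W * H) (mat_adjoint H * W) (mat_adjoint H * H)"
    using assms by (subst mult_four_block_mat[where ?nr1.0 = n and ?n1.0 = d and ?n2.0 = 0
          and ?nr2.0 = m and ?nc1.0 = n and ?nc2.0 = m]) auto
  ultimately show ?thesis by simp
qed

fun hcat :: "nat \<Rightarrow> complex mat list \<Rightarrow> complex mat" where
  "hcat d [] = 0\<^sub>m d 0"
| "hcat d (W # Ws) = beside W (hcat d Ws)"

lemma hcat_carrier:
  assumes "\<And>s. s \<in> set ps \<Longrightarrow> W s \<in> carrier_mat d (n s)"
  shows "hcat d (map W ps) \<in> carrier_mat d (\<Sum>s\<leftarrow>ps. n s)"
  using assms by (induction ps) (auto intro: beside_carrier)

text \<open>Blocks that intertwine \<open>M\<close> with the matrices \<open>A s\<close> one by one intertwine it, side by side, with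
  their block diagonal sum.\<close>

lemma hcat_intertwines:
  assumes M: "M \<in> carrier_mat d d"
    and W: "\<And>s. s \<in> set ps \<Longrightarrow> W s \<in> carrier_mat d (n s)"
    and A: "\<And>s. s \<in> set ps \<Longrightarrow> A s \<in> carrier_mat (n s) (n s)"
    and eq: "\<And>s. s \<in> set ps \<Longrightarrow> M * W s = W s * A s"
  shows "M * hcat d (map W ps) = hcat d (map W ps) * diag_block_mat (map A ps)"
  using W A eq
proof (induction ps)
  case Nil
  then show ?case using M by (intro eq_matI) auto
next
  case (Cons s ps)
  let ?m = "\<Sum>s\<leftarrow>ps. n s"
  have IH: "M * hcat d (map W ps) = hcat d (map W ps) * diag_block_mat (map A ps)"
    using Cons.prems by (intro Cons.IH) auto
  have H: "hcat d (map W ps) \<in> carrier_mat d ?m"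
    using Cons.prems by (intro hcat_carrier) auto
  have dims: "dim_row (A s) = n s" "dim_col (A s) = n s" if "s \<in> set ps" for s
    using Cons.prems(2)[of s] that by auto
  have D: "diag_block_mat (map A ps) \<in> carrier_mat ?m ?m"
    by (rule carrier_matI) (simp_all add: dim_diag_block_mat o_def dims cong: map_cong)
  have s: "W s \<in> carrier_mat d (n s)" "A s \<in> carrier_mat (n s) (n s)" "M * W s = W s * A s"
    using Cons.prems by auto
  have eq: "diag_block_mat (map A (s # ps)) =
      four_block_mat (A s) (0\<^sub>m (n s) ?m) (0\<^sub>m ?m (n s)) (diag_block_mat (map A ps))"
    using s(2) D by (simp add: Let_def)
  show ?case
    unfolding eq using IH s by (simp add: mult_beside[OF M s(1) H] beside_mult_diag[OF s(1) H s(2) D])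
qed

lemma hcat_orthogonal:
  assumes V: "V \<in> carrier_mat k d"
    and W: "\<And>s. s \<in> set ps \<Longrightarrow> W s \<in> carrier_mat d (n s)"
    and eq: "\<And>s. s \<in> set ps \<Longrightarrow> V * W s = 0\<^sub>m k (n s)"
  shows "V * hcat d (map W ps) = 0\<^sub>m k (\<Sum>s\<leftarrow>ps. n s)"
  using W eq
proof (induction ps)
  case Nil
  then show ?case using V by (intro eq_matI) auto
next
  case (Cons s ps)
  have H: "hcat d (map W ps) \<in> carrier_mat d (\<Sum>s\<leftarrow>ps. n s)"
    using Cons.prems by (intro hcat_carrier) auto
  have "V * hcat d (map W ps) = 0\<^sub>m k (\<Sum>s\<leftarrow>ps. n s)"
    using Cons.prems by (intro Cons.IH) auto
  moreover have "W s \<in> carrier_mat d (n s)" "V * W s = 0\<^sub>m k (n s)"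
    using Cons.prems by auto
  ultimately show ?case
    using mult_beside[OF V _ H, of "W s" "n s"] by (auto simp: beside_def intro!: eq_matI)
qed

lemma hcat_isometry:
  assumes "distinct ps"
    and W: "\<And>s. s \<in> set ps \<Longrightarrow> W s \<in> carrier_mat d (n s)"
    and iso: "\<And>s. s \<in> set ps \<Longrightarrow> mat_adjoint (W s) * W s = 1\<^sub>m (n s)"
    and orth: "\<And>s t. s \<in> set ps \<Longrightarrow> t \<in> set ps \<Longrightarrow> s \<noteq> t \<Longrightarrow> mat_adjoint (W s) * W t = 0\<^sub>m (n s) (n t)"
  shows "mat_adjoint (hcat d (map W ps)) * hcat d (map W ps) = 1\<^sub>m (\<Sum>s\<leftarrow>ps. n s)"
  using assms
proof (induction ps)
  case Nil
  show ?case by (intro eq_matI) auto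
next
  case (Cons s ps)
  let ?H = "hcat d (map W ps)" and ?m = "\<Sum>s\<leftarrow>ps. n s"
  have H: "?H \<in> carrier_mat d ?m"
    using Cons.prems by (intro hcat_carrier) auto
  have Ws: "W s \<in> carrier_mat d (n s)" "mat_adjoint (W s) * W s = 1\<^sub>m (n s)"
    using Cons.prems(2,3)[of s] by auto
  have HH: "mat_adjoint ?H * ?H = 1\<^sub>m ?m"
    using Cons.prems by (intro Cons.IH) auto
  have WH: "mat_adjoint (W s) * ?H = 0\<^sub>m (n s) ?m"
    using Cons.prems Ws by (intro hcat_orthogonal) auto
  then have "mat_adjoint (mat_adjoint (W s) * ?H) = 0\<^sub>m ?m (n s)" by simp
  then have HW: "mat_adjoint ?H * W s = 0\<^sub>m ?m (n s)"
    using mat_adjoint_mult[of "mat_adjoint (W s)" "n s" d ?H ?m] Ws H by simp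
  show ?case by (simp add: beside_gram[OF Ws(1) H] Ws(2) HH WH HW)
qed

section \<open>Unital *-representations of a tuple of matrix algebras\<close>

locale matrix_rep =
  fixes ns :: "nat list" and d :: nat and \<psi> :: "complex mat list \<Rightarrow> complex mat"
  assumes carrier: "a \<in> matrix_tuples ns \<Longrightarrow> \<psi> a \<in> carrier_mat d d"
    and add: "a \<in> matrix_tuples ns \<Longrightarrow> b \<in> matrix_tuples ns \<Longrightarrow> \<psi> (map2 (+) a b) = \<psi> a + \<psi> b"
    and mult: "a \<in> matrix_tuples ns \<Longrightarrow> b \<in> matrix_tuples ns \<Longrightarrow> \<psi> (map2 (*) a b) = \<psi> a * \<psi> b"
    and smult: "a \<in> matrix_tuples ns \<Longrightarrow> \<psi> (map ((\<cdot>\<^sub>m) c) a) = c \<cdot>\<^sub>m \<psi> a"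
    and adjoint: "a \<in> matrix_tuples ns \<Longrightarrow> \<psi> (map mat_adjoint a) = mat_adjoint (\<psi> a)"
    and one: "\<psi> (map 1\<^sub>m ns) = 1\<^sub>m d"

lemma matrix_rep_multiplicity_sum:
  assumes "length cs = length ns"
  shows "matrix_rep ns (\<Sum>i<length ns. cs ! i * ns ! i) (multiplicity_sum cs)"
proof -
  have ts: "set (block_order cs) \<subseteq> {..<length ns}"
    using assms by (auto simp: set_block_order)
  have d: "(\<Sum>i<length ns. cs ! i * ns ! i) = (\<Sum>i\<leftarrow>block_order cs. ns ! i)"
    using sum_list_block_order[of "(!) ns" cs] assms by simp
  have eq: "multiplicity_sum cs a = block_sum (block_order cs) a" if "a \<in> matrix_tuples ns" for a
    using multiplicity_sum_eq[of cs a] matrix_tuplesD(1)[OF that] assms by simp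
  show ?thesis
    unfolding d by unfold_locales (simp_all add: eq block_sum_carrier[OF ts] block_sum_hom(1-4)[OF ts]
        block_sum_hom(5)[OF ts matrix_tuples_closed(1) matrix_tuples_closed(1)])
qed

lemma trace_multiplicity_sum:
  assumes "length cs = length ns" and a: "a \<in> matrix_tuples ns"
  shows "trace (multiplicity_sum cs a) = (\<Sum>i<length ns. of_nat (cs ! i) * trace (a ! i))"
proof -
  have ts: "set (block_order cs) \<subseteq> {..<length ns}"
    using assms by (auto simp: set_block_order)
  show ?thesis
    using assms multiplicity_sum_eq[of cs a] matrix_tuplesD(1)[OF a] block_sum_hom(6)[OF ts a a]
      sum_list_block_order[of "\<lambda>i. trace (a ! i)" cs] by simp
qed

text \<open>Positive multiplicities make every entry of the tuple visible on the diagonal; this is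
  the faithfulness of the standard action.\<close>

lemma multiplicity_sum_inj:
  assumes "length cs = length ns" "a \<in> matrix_tuples ns" "b \<in> matrix_tuples ns"
    and pos: "\<forall>c\<in>set cs. 0 < c" and eq: "multiplicity_sum cs a = multiplicity_sum cs b"
  shows "a = b"
proof (rule matrix_tuples_eqI[OF assms(2,3)])
  fix j assume "j < length ns"
  then have "j \<in> set (block_order cs)"
    using assms(1) pos by (simp add: set_block_order)
  then show "a ! j = b ! j"
    using assms multiplicity_sum_eq[of cs a] multiplicity_sum_eq[of cs b] matrix_tuplesD(1)[of _ ns]
    by (intro block_sum_inj[of "block_order cs" ns a b]) (auto simp: set_block_order)
qed

text \<open>A minimal projection of the \<open>i\<close>-th summand. The trace of its image counts how often a
  representation contains that summand.\<close>

abbreviation corner :: "nat list \<Rightarrow> nat \<Rightarrow> complex mat list" where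
  "corner ns i \<equiv> matrix_unit ns i 0 0"

lemma trace_corner:
  assumes "j < length ns" "0 < ns ! i"
  shows "trace (corner ns i ! j) = (if j = i then 1 else 0)"
  using assms inner_unit_vec[of "ns ! i" 0] by (simp add: trace_rank_one[where n = "ns ! i"])

lemma trace_multiplicity_sum_corner:
  assumes "length cs = length ns" "i < length ns" "0 < ns ! i"
  shows "trace (multiplicity_sum cs (corner ns i)) = of_nat (cs ! i)"
proof -
  have "trace (multiplicity_sum cs (corner ns i)) =
      (\<Sum>j<length ns. of_nat (cs ! j) * (if j = i then 1 else 0))"
    using assms by (simp add: trace_multiplicity_sum trace_corner del: nth_at_block)
  also have "\<dots> = of_nat (cs ! i)"
    using assms(2) by (simp add: if_distrib sum.delta cong: if_cong)
  finally show ?thesis .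
qed

context matrix_rep
begin

lemma zero: "\<psi> (map (\<lambda>k. 0\<^sub>m k k) ns) = 0\<^sub>m d d"
proof -
  have "map (\<lambda>k. 0\<^sub>m k k) ns = map ((\<cdot>\<^sub>m) 0) (map 1\<^sub>m ns :: complex mat list)"
    by (intro nth_equalityI) (auto intro!: eq_matI)
  moreover have "\<psi> (map ((\<cdot>\<^sub>m) 0) (map 1\<^sub>m ns)) = 0 \<cdot>\<^sub>m 1\<^sub>m d"
    using smult[of "map 1\<^sub>m ns" 0] one by simp
  moreover have "0 \<cdot>\<^sub>m 1\<^sub>m d = (0\<^sub>m d d :: complex mat)"
    by (intro eq_matI) auto
  ultimately show ?thesis by (simp only:)
qed

text \<open>Since \<open>v w\<^sup>* = (v e\<^sup>*) (e w\<^sup>*)\<close> for the unit vector \<open>e\<close>, commuting the two factors under the trace leaves a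
  multiple of the corner \<open>e e\<^sup>*\<close>.\<close>

lemma trace_rank_one_block:
  assumes i: "i < length ns" "0 < ns ! i" and v: "v \<in> carrier_vec (ns ! i)" and w: "w \<in> carrier_vec (ns ! i)"
  shows "trace (\<psi> (at_block ns i (rank_one v w))) = (v \<bullet>c w) * trace (\<psi> (corner ns i))"
proof -
  let ?n = "ns ! i"
  let ?e = "unit_vec ?n 0 :: complex vec"
  have e: "?e \<in> carrier_vec ?n" "?e \<bullet>c ?e = 1" using inner_unit_vec[of ?n 0] i by auto
  have c: "at_block ns i (rank_one v ?e) \<in> matrix_tuples ns" "at_block ns i (rank_one ?e w) \<in> matrix_tuples ns"
    "corner ns i \<in> matrix_tuples ns"
    using v w by simp_all
  have "at_block ns i (rank_one v w) = map2 (*) (at_block ns i (rank_one v ?e)) (at_block ns i (rank_one ?e w))"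
    using i v w e by (simp add: at_block_mult_at_block rank_one_mult_rank_one[where n = ?n] flip: rank_one_smult)
  then have "trace (\<psi> (at_block ns i (rank_one v w))) =
      trace (\<psi> (at_block ns i (rank_one v ?e)) * \<psi> (at_block ns i (rank_one ?e w)))"
    using c by (simp add: mult)
  also have "\<dots> = trace (\<psi> (at_block ns i (rank_one ?e w)) * \<psi> (at_block ns i (rank_one v ?e)))"
    by (rule trace_mult_comm[OF carrier[OF c(1)] carrier[OF c(2)]])
  also have "\<dots> = trace (\<psi> (map2 (*) (at_block ns i (rank_one ?e w)) (at_block ns i (rank_one v ?e))))"
    using c by (simp add: mult)
  also have "map2 (*) (at_block ns i (rank_one ?e w)) (at_block ns i (rank_one v ?e)) =
      map ((\<cdot>\<^sub>m) (v \<bullet>c w)) (corner ns i)"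
    using i v w by (simp add: at_block_mult_at_block rank_one_mult_rank_one[where n = ?n] at_block_smult)
  also have "trace (\<psi> \<dots>) = (v \<bullet>c w) * trace (\<psi> (corner ns i))"
    using c by (simp add: smult trace_smult[OF carrier])
  finally show ?thesis .
qed

text \<open>Both sides are linear in \<open>a\<close>, so it suffices to compare them on matrix units. At the unit element
  this is the dimension count that makes the intertwiners fill the whole space.\<close>

lemma trace_rep:
  assumes pos: "\<forall>k\<in>set ns. 0 < k" and a: "a \<in> matrix_tuples ns"
  shows "trace (\<psi> a) = (\<Sum>i<length ns. trace (\<psi> (corner ns i)) * trace (a ! i))"
  using a
proof (induction rule: matrix_tuples_span)
  case zero
  show ?case by (simp add: matrix_rep.zero[OF matrix_rep_axioms])
next
  case (add a b)
  have "trace ((map2 (+) a b) ! i) = trace (a ! i) + trace (b ! i)" if "i < length ns" for i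
    using that add(1,2) by (simp add: matrix_tuplesD trace_add[OF matrix_tuplesD(2) matrix_tuplesD(2)])
  then show ?case
    using add
    by (simp add: matrix_rep.add[OF matrix_rep_axioms] trace_add[OF carrier carrier] sum.distrib distrib_left)
next
  case (smult c a)
  have "trace ((map ((\<cdot>\<^sub>m) c) a) ! i) = c * trace (a ! i)" if "i < length ns" for i
    using that smult(1) by (simp add: matrix_tuplesD trace_smult[OF matrix_tuplesD(2)])
  then show ?case
    using smult
    by (simp add: matrix_rep.smult[OF matrix_rep_axioms] trace_smult[OF carrier] sum_distrib_left mult.left_commute)
next
  case (unit i k l)
  let ?n = "ns ! i"
  let ?x = "unit_vec ?n k \<bullet>c unit_vec ?n l :: complex"
  have "(\<Sum>j<length ns. trace (\<psi> (corner ns j)) * trace (matrix_unit ns i k l ! j)) =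
      (\<Sum>j<length ns. trace (\<psi> (corner ns j)) * (if j = i then ?x else 0))"
    by (intro sum.cong) (auto simp: trace_rank_one[where n = ?n])
  also have "\<dots> = trace (\<psi> (corner ns i)) * ?x"
    using unit(1) by (simp add: if_distrib sum.delta cong: if_cong)
  also have "\<dots> = ?x * trace (\<psi> (corner ns i))" by (rule mult.commute)
  also have "\<dots> = trace (\<psi> (matrix_unit ns i k l))"
    using unit(1) pos by (intro trace_rank_one_block[symmetric]) simp_all
  finally show ?case ..
qed

text \<open>A vector \<open>f\<close> yields the linear map \<open>x \<mapsto> \<psi>(x e\<^sup>*) f\<close>. It intertwines \<open>\<psi>\<close> with the \<open>i\<close>-th coordinate because
  \<open>a (x e\<^sup>*) = (a x) e\<^sup>*\<close>.\<close>

lemma intertwiner_exists: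
  assumes "i < length ns" and f: "f \<in> carrier_vec d"
  shows "\<exists>W\<in>carrier_mat d (ns ! i). \<forall>x\<in>carrier_vec (ns ! i).
    \<psi> (at_block ns i (rank_one x (unit_vec (ns ! i) 0))) *\<^sub>v f = W *\<^sub>v x"
proof (rule linear_map_matrix)
  let ?n = "ns ! i"
  let ?e = "unit_vec ?n 0 :: complex vec"
  have c: "at_block ns i (rank_one x ?e) \<in> matrix_tuples ns" if "x \<in> carrier_vec ?n" for x
    using that by simp
  show "\<psi> (at_block ns i (rank_one x ?e)) *\<^sub>v f \<in> carrier_vec d" if "x \<in> carrier_vec ?n" for x
    using carrier[OF c[OF that]] f by simp
  show "\<psi> (at_block ns i (rank_one (x + y) ?e)) *\<^sub>v f =
      \<psi> (at_block ns i (rank_one x ?e)) *\<^sub>v f + \<psi> (at_block ns i (rank_one y ?e)) *\<^sub>v f"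
    if x: "x \<in> carrier_vec ?n" and y: "y \<in> carrier_vec ?n" for x y
  proof -
    have "at_block ns i (rank_one (x + y) ?e) = map2 (+) (at_block ns i (rank_one x ?e)) (at_block ns i (rank_one y ?e))"
      using x y by (simp add: rank_one_add[where n = ?n] at_block_add)
    then show ?thesis
      using f by (simp add: add[OF c[OF x] c[OF y]] add_mult_distrib_mat_vec[OF carrier[OF c[OF x]] carrier[OF c[OF y]]])
  qed
  show "\<psi> (at_block ns i (rank_one (t \<cdot>\<^sub>v x) ?e)) *\<^sub>v f = t \<cdot>\<^sub>v (\<psi> (at_block ns i (rank_one x ?e)) *\<^sub>v f)"
    if x: "x \<in> carrier_vec ?n" for x t
  proof -
    have "at_block ns i (rank_one (t \<cdot>\<^sub>v x) ?e) = map ((\<cdot>\<^sub>m) t) (at_block ns i (rank_one x ?e))"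
      using x by (simp add: rank_one_smult at_block_smult)
    then show ?thesis
      using f by (simp add: smult[OF c[OF x]] smult_mat_mult_vec[OF carrier[OF c[OF x]]])
  qed
qed

lemma rep_intertwiner:
  assumes i: "i < length ns" "0 < ns ! i" and f: "f \<in> carrier_vec d" and W: "W \<in> carrier_mat d (ns ! i)"
    and eq: "\<And>x. x \<in> carrier_vec (ns ! i) \<Longrightarrow>
      \<psi> (at_block ns i (rank_one x (unit_vec (ns ! i) 0))) *\<^sub>v f = W *\<^sub>v x"
    and a: "a \<in> matrix_tuples ns"
  shows "\<psi> a * W = W * a ! i"
proof (rule mat_eq_if_mult_vec_eq)
  let ?n = "ns ! i"
  let ?e = "unit_vec ?n 0 :: complex vec"
  have ai: "a ! i \<in> carrier_mat ?n ?n" using matrix_tuplesD(2)[OF a i(1)] .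
  note \<psi>a = carrier[OF a]
  show "\<psi> a * W \<in> carrier_mat d ?n" "W * a ! i \<in> carrier_mat d ?n"
    using \<psi>a ai W by simp_all
  fix x :: "complex vec" assume x: "x \<in> carrier_vec ?n"
  have c: "at_block ns i (rank_one x ?e) \<in> matrix_tuples ns" using x by simp
  have "(\<psi> a * W) *\<^sub>v x = \<psi> a *\<^sub>v (\<psi> (at_block ns i (rank_one x ?e)) *\<^sub>v f)"
    using x by (simp add: assoc_mult_mat_vec[OF \<psi>a W] eq)
  also have "\<dots> = \<psi> (map2 (*) a (at_block ns i (rank_one x ?e))) *\<^sub>v f"
    using f by (simp add: mult[OF a c] assoc_mult_mat_vec[OF \<psi>a carrier[OF c]])
  also have "map2 (*) a (at_block ns i (rank_one x ?e)) = at_block ns i (rank_one (a ! i *\<^sub>v x) ?e)"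
    using x by (simp add: mult_at_block[OF a] mult_rank_one[OF ai])
  also have "\<psi> \<dots> *\<^sub>v f = W *\<^sub>v (a ! i *\<^sub>v x)"
    using ai x by (intro eq) simp
  also have "\<dots> = (W * a ! i) *\<^sub>v x"
    using x by (simp add: assoc_mult_mat_vec[OF W ai])
  finally show "(\<psi> a * W) *\<^sub>v x = (W * a ! i) *\<^sub>v x" .
qed

text \<open>The inner products of the columns reduce to
  \<open>\<langle>\<psi>(x e\<^sup>*) g, \<psi>(y e\<^sup>*) f\<rangle> = \<langle>\<psi>(e y\<^sup>* x e\<^sup>*) g, f\<rangle>\<close> when both vectors belong to the same summand, and the
  operator on the right is a scalar multiple of the image of a corner, which fixes \<open>g\<close>. For different
  summands the product of the two arguments of \<open>\<psi>\<close> vanishes. Hence orthonormal vectors in the ranges of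
  the corners give isometries with pairwise orthogonal ranges.\<close>

lemma intertwiner_gram:
  assumes i: "i < length ns" "0 < ns ! i" and f: "f \<in> carrier_vec d" and W: "W \<in> carrier_mat d (ns ! i)"
    and eq: "\<And>x. x \<in> carrier_vec (ns ! i) \<Longrightarrow>
      \<psi> (at_block ns i (rank_one x (unit_vec (ns ! i) 0))) *\<^sub>v f = W *\<^sub>v x"
    and j: "j < length ns" "0 < ns ! j" and g: "g \<in> carrier_vec d" "\<psi> (corner ns j) *\<^sub>v g = g"
    and V: "V \<in> carrier_mat d (ns ! j)"
    and eqV: "\<And>x. x \<in> carrier_vec (ns ! j) \<Longrightarrow>
      \<psi> (at_block ns j (rank_one x (unit_vec (ns ! j) 0))) *\<^sub>v g = V *\<^sub>v x"
  shows "mat_adjoint W * V = (if i = j then (g \<bullet>c f) \<cdot>\<^sub>m 1\<^sub>m (ns ! i) else 0\<^sub>m (ns ! i) (ns ! j))"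
    (is "_ = ?R")
proof (rule mat_eq_if_inner_eq)
  let ?n = "ns ! i" and ?m = "ns ! j"
  let ?e = "unit_vec ?n 0 :: complex vec" and ?e' = "unit_vec ?m 0 :: complex vec"
  show "mat_adjoint W * V \<in> carrier_mat ?n ?m" "?R \<in> carrier_mat ?n ?m"
    using W V by auto
  fix x y :: "complex vec" assume x: "x \<in> carrier_vec ?m" and y: "y \<in> carrier_vec ?n"
  let ?X = "at_block ns j (rank_one x ?e')" and ?Y = "at_block ns i (rank_one y ?e)"
  let ?Z = "at_block ns i (rank_one ?e y)"
  have c: "?X \<in> matrix_tuples ns" "?Y \<in> matrix_tuples ns" "?Z \<in> matrix_tuples ns" "corner ns j \<in> matrix_tuples ns"
    using x y by simp_all
  have YZ: "map mat_adjoint ?Y = ?Z"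
    using y by (simp add: at_block_adjoint)
  have "((mat_adjoint W * V) *\<^sub>v x) \<bullet>c y = (mat_adjoint W *\<^sub>v (V *\<^sub>v x)) \<bullet>c y"
    using x by (simp add: assoc_mult_mat_vec[OF mat_adjoint_carrier[OF W] V])
  also have "\<dots> = (V *\<^sub>v x) \<bullet>c (W *\<^sub>v y)"
    using x y W V inner_mult_mat_vec[of "mat_adjoint W" ?n d "V *\<^sub>v x" y] by simp
  also have "\<dots> = (\<psi> ?X *\<^sub>v g) \<bullet>c (\<psi> ?Y *\<^sub>v f)"
    using x y by (simp add: eq eqV)
  also have "\<dots> = (mat_adjoint (\<psi> ?Y) *\<^sub>v (\<psi> ?X *\<^sub>v g)) \<bullet>c f"
    using inner_mult_mat_vec[of "mat_adjoint (\<psi> ?Y)" d d "\<psi> ?X *\<^sub>v g" f] carrier[OF c(1)] carrier[OF c(2)] f g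
    by simp
  also have "mat_adjoint (\<psi> ?Y) *\<^sub>v (\<psi> ?X *\<^sub>v g) = \<psi> (map2 (*) ?Z ?X) *\<^sub>v g"
    using g by (simp add: adjoint[OF c(2), symmetric] YZ mult[OF c(3,1)]
        assoc_mult_mat_vec[OF carrier[OF c(3)] carrier[OF c(1)]])
  also have "\<dots> \<bullet>c f = (?R *\<^sub>v x) \<bullet>c y"
  proof (cases "i = j")
    case True
    have "map2 (*) ?Z ?X = map ((\<cdot>\<^sub>m) (x \<bullet>c y)) (corner ns j)"
      using i x y True by (simp add: at_block_mult_at_block rank_one_mult_rank_one[where n = ?m] at_block_smult)
    then have "\<psi> (map2 (*) ?Z ?X) *\<^sub>v g = (x \<bullet>c y) \<cdot>\<^sub>v g"
      using g by (simp add: smult[OF c(4)] smult_mat_mult_vec[OF carrier[OF c(4)]])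
    moreover have "?R *\<^sub>v x = (g \<bullet>c f) \<cdot>\<^sub>v x"
      using x True by (simp add: smult_mat_mult_vec[OF one_carrier_mat])
    ultimately show ?thesis
      using f g x y True by simp
  next
    case False
    have "\<psi> (map2 (*) ?Z ?X) *\<^sub>v g = 0\<^sub>v d"
      using i j x y g False by (simp add: at_block_mult_at_block zero) (intro eq_vecI, simp_all)
    moreover have "?R *\<^sub>v x = 0\<^sub>v ?n"
      using x False by (simp) (intro eq_vecI, simp_all)
    ultimately show ?thesis using f y by simp
  qed
  finally show "((mat_adjoint W * V) *\<^sub>v x) \<bullet>c y = (?R *\<^sub>v x) \<bullet>c y" .
qed

lemma corner_projection:
  assumes i: "i < length ns" "0 < ns ! i"
  shows "\<psi> (corner ns i) * \<psi> (corner ns i) = \<psi> (corner ns i)"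
    "mat_adjoint (\<psi> (corner ns i)) = \<psi> (corner ns i)"
proof -
  have c: "corner ns i \<in> matrix_tuples ns" by simp
  have "map2 (*) (corner ns i) (corner ns i) = corner ns i"
    using i inner_unit_vec[of "ns ! i" 0]
    by (simp add: at_block_mult_at_block rank_one_mult_rank_one[where n = "ns ! i"] flip: rank_one_smult)
  then show "\<psi> (corner ns i) * \<psi> (corner ns i) = \<psi> (corner ns i)"
    using mult[OF c c] by simp
  show "mat_adjoint (\<psi> (corner ns i)) = \<psi> (corner ns i)"
    using adjoint[OF c] by (simp add: at_block_adjoint)
qed

text \<open>The unitary is made of the intertwiners attached to orthonormal bases of the ranges of the
  corners, listed summand by summand.\<close>

lemma unitarily_standard:
  assumes pos: "\<forall>k\<in>set ns. 0 < k"
  shows "\<exists>cs U. length cs = length ns \<and> d = (\<Sum>i<length ns. cs ! i * ns ! i) \<and>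
    (\<forall>i<length ns. trace (\<psi> (corner ns i)) = of_nat (cs ! i)) \<and> U \<in> unitary_group d \<and>
    (\<forall>a\<in>matrix_tuples ns. \<psi> a = U * multiplicity_sum cs a * mat_adjoint U)"
proof -
  let ?l = "length ns"
  have npos: "0 < ns ! i" if "i < ?l" for i using pos that by simp
  have "\<forall>i. \<exists>fs. i < ?l \<longrightarrow> trace (\<psi> (corner ns i)) = of_nat (length fs) \<and>
    (\<forall>f\<in>set fs. f \<in> carrier_vec d \<and> \<psi> (corner ns i) *\<^sub>v f = f) \<and>
    (\<forall>m<length fs. \<forall>m'<length fs. fs ! m \<bullet>c fs ! m' = (if m = m' then 1 else 0))"
    using projection_orthonormal_basis[OF carrier corner_projection] npos by simp
  then obtain F where F: "\<And>i. i < ?l \<Longrightarrow> trace (\<psi> (corner ns i)) = of_nat (length (F i))"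
    "\<And>i m. i < ?l \<Longrightarrow> m < length (F i) \<Longrightarrow> F i ! m \<in> carrier_vec d \<and> \<psi> (corner ns i) *\<^sub>v (F i ! m) = F i ! m"
    "\<And>i m m'. i < ?l \<Longrightarrow> m < length (F i) \<Longrightarrow> m' < length (F i) \<Longrightarrow>
      F i ! m \<bullet>c F i ! m' = (if m = m' then 1 else 0)"
    by (metis nth_mem)
  define cs where "cs = map (\<lambda>i. length (F i)) [0..<?l]"
  have cs: "length cs = ?l" "\<And>i. i < ?l \<Longrightarrow> cs ! i = length (F i)" by (auto simp: cs_def)
  \<comment> \<open>One index per block column: the summand \<open>i\<close> and the number \<open>m\<close> of the basis vector in \<open>F i\<close>.\<close>
  define ps where "ps = concat (map (\<lambda>i. map (Pair i) [0..<cs ! i]) [0..<?l])"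
  have set_ps: "set ps = {(i, m). i < ?l \<and> m < cs ! i}"
    by (auto simp: ps_def)
  have "distinct (concat (map (\<lambda>i. map (Pair i) [0..<cs ! i]) is))" if "distinct is" for "is"
    using that by (induction "is") (auto simp: distinct_map inj_on_def)
  then have distinct: "distinct ps" by (simp add: ps_def)
  have fst_ps: "map fst ps = block_order cs"
    by (simp add: ps_def block_order_def map_concat o_def cs(1) map_replicate_const)
  have s: "fst s < ?l" "0 < ns ! fst s" "F (fst s) ! snd s \<in> carrier_vec d"
    "\<psi> (corner ns (fst s)) *\<^sub>v (F (fst s) ! snd s) = F (fst s) ! snd s" if "s \<in> set ps" for s
    using that F(2) npos cs(2) by (auto simp: set_ps)
  have "\<forall>s\<in>set ps. \<exists>W. W \<in> carrier_mat d (ns ! fst s) \<and> (\<forall>x\<in>carrier_vec (ns ! fst s).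
    \<psi> (at_block ns (fst s) (rank_one x (unit_vec (ns ! fst s) 0))) *\<^sub>v (F (fst s) ! snd s) = W *\<^sub>v x)"
    using intertwiner_exists[OF s(1,3)] by blast
  from bchoice[OF this] obtain W where W: "\<And>s. s \<in> set ps \<Longrightarrow> W s \<in> carrier_mat d (ns ! fst s)"
    "\<And>s x. s \<in> set ps \<Longrightarrow> x \<in> carrier_vec (ns ! fst s) \<Longrightarrow>
      \<psi> (at_block ns (fst s) (rank_one x (unit_vec (ns ! fst s) 0))) *\<^sub>v (F (fst s) ! snd s) = W s *\<^sub>v x"
    by blast
  have gram: "mat_adjoint (W s) * W t =
    (if s = t then 1\<^sub>m (ns ! fst s) else 0\<^sub>m (ns ! fst s) (ns ! fst t))" if st: "s \<in> set ps" "t \<in> set ps" for s t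
  proof -
    have "mat_adjoint (W s) * W t = (if fst s = fst t
        then (F (fst t) ! snd t \<bullet>c F (fst s) ! snd s) \<cdot>\<^sub>m 1\<^sub>m (ns ! fst s) else 0\<^sub>m (ns ! fst s) (ns ! fst t))"
      by (rule intertwiner_gram[OF s(1-3)[OF st(1)] W(1)[OF st(1)] W(2)[OF st(1)]
            s[OF st(2)] W(1)[OF st(2)] W(2)[OF st(2)]])
    also have "\<dots> = (if s = t then 1\<^sub>m (ns ! fst s) else 0\<^sub>m (ns ! fst s) (ns ! fst t))"
      using st cs(2) F(3)[of "fst s" "snd t" "snd s"]
      by (cases "s = t") (auto simp: set_ps prod_eq_iff smult_one_mat)
    finally show ?thesis .
  qed
  define U where "U = hcat d (map W ps)"
  \<comment> \<open>The block columns have \<open>d\<close> columns in total, so the isometry they form is a square matrix.\<close>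
  have "(of_nat d :: complex) = trace (\<psi> (map 1\<^sub>m ns))" by (simp add: one)
  also have "\<dots> = (\<Sum>i<?l. of_nat (cs ! i) * of_nat (ns ! i))"
    by (subst trace_rep[OF pos]) (simp_all add: F(1) cs(2))
  also have "\<dots> = of_nat (\<Sum>i<?l. cs ! i * ns ! i)" by simp
  finally have d: "d = (\<Sum>i<?l. cs ! i * ns ! i)"
    using of_nat_eq_iff by blast
  also have "\<dots> = (\<Sum>i\<leftarrow>map fst ps. ns ! i)"
    unfolding fst_ps using sum_list_block_order[of "(!) ns" cs] cs(1) by simp
  finally have dim: "(\<Sum>s\<leftarrow>ps. ns ! fst s) = d" by (simp add: o_def)
  have U: "U \<in> carrier_mat d d"
    using hcat_carrier[of ps W d "\<lambda>s. ns ! fst s"] W(1) by (simp add: U_def dim)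
  have UU: "mat_adjoint U * U = 1\<^sub>m d"
    using hcat_isometry[OF distinct, of W d "\<lambda>s. ns ! fst s"] W(1) gram by (simp add: U_def dim)
  then have UU': "U * mat_adjoint U = 1\<^sub>m d"
    using U mat_mult_left_right_inverse[of "mat_adjoint U" d U] by simp
  have "\<psi> a = U * multiplicity_sum cs a * mat_adjoint U" if a: "a \<in> matrix_tuples ns" for a
  proof -
    have "\<psi> a * U = U * diag_block_mat (map (\<lambda>s. a ! fst s) ps)"
      unfolding U_def
    proof (rule hcat_intertwines[where n = "\<lambda>s. ns ! fst s"])
      show "\<psi> a * W t = W t * a ! fst t" if "t \<in> set ps" for t
        by (rule rep_intertwiner[OF s(1-3)[OF that] W(1)[OF that] W(2)[OF that] a])
    qed (simp_all add: carrier[OF a] W(1) matrix_tuplesD(2)[OF a s(1)])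
    also have "map (\<lambda>s. a ! fst s) ps = map ((!) a) (block_order cs)"
      by (simp flip: fst_ps)
    also have "diag_block_mat \<dots> = multiplicity_sum cs a"
      using multiplicity_sum_eq[of cs a] matrix_tuplesD(1)[OF a] cs(1) by (simp add: block_sum_def)
    finally have "\<psi> a * U * mat_adjoint U = U * multiplicity_sum cs a * mat_adjoint U" by simp
    then show ?thesis
      using assoc_mult_mat[OF carrier[OF a] U, of "mat_adjoint U" d] U UU' carrier[OF a] by simp
  qed
  then show ?thesis
    using cs F(1) d U UU UU' unfolding unitary_group_def
    by (intro exI[of _ cs] exI[of _ U] conjI allI impI ballI CollectI) simp_all
qed

end


section \<open>The objects are prespectral triples\<close>

lemma matrix_alg_simps [simp]:
  "carrier (matrix_alg ns) = matrix_tuples ns"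
  "monoid.mult (matrix_alg ns) = map2 (*)"
  "one (matrix_alg ns) = map 1\<^sub>m ns"
  "zero (matrix_alg ns) = map (\<lambda>k. 0\<^sub>m k k) ns"
  "add (matrix_alg ns) = map2 (+)"
  "module.smult (matrix_alg ns) = (\<lambda>c. map ((\<cdot>\<^sub>m) c))"
  "star (matrix_alg ns) = map mat_adjoint"
  by (simp_all add: matrix_alg_def)

lemma std_hilb_simps [simp]:
  "carrier (std_hilb d) = carrier_vec d"
  "zero (std_hilb d) = 0\<^sub>v d"
  "add (std_hilb d) = (+)"
  "module.smult (std_hilb d) = (\<cdot>\<^sub>v)"
  "inner (std_hilb d) = (\<lambda>v w. v \<bullet>c w)"
  by (simp_all add: std_hilb_def module.defs hilb.defs module_vec_def)

lemma nth_map2_tuples: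
  "a \<in> matrix_tuples ns \<Longrightarrow> b \<in> matrix_tuples ns \<Longrightarrow> j < length ns \<Longrightarrow> map2 f a b ! j = f (a ! j) (b ! j)"
  by (simp add: matrix_tuplesD)

lemma nth_map_tuples:
  "a \<in> matrix_tuples ns \<Longrightarrow> j < length ns \<Longrightarrow> map f a ! j = f (a ! j)"
  by (simp add: matrix_tuplesD)

lemma module_matrix_alg: "Module.module (class_ring :: complex ring) (matrix_alg ns)"
proof (rule module_criteria, unfold matrix_alg_simps ring.simps monoid.simps partial_object.simps, safe)
  note nth = nth_map2_tuples[where ns = ns] nth_map_tuples[where ns = ns]
  note eqI = matrix_tuples_eqI[where ns = ns]
  show "cring (class_ring :: complex ring)" ..
  fix a b c :: "complex mat list" and x y :: complex
  assume a: "a \<in> matrix_tuples ns"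
  show "\<exists>n\<in>matrix_tuples ns. map2 (+) a n = map (\<lambda>k. 0\<^sub>m k k) ns"
  proof (rule bexI[of _ "map ((\<cdot>\<^sub>m) (-1)) a"], rule eqI)
    fix j assume j: "j < length ns"
    then show "map2 (+) a (map ((\<cdot>\<^sub>m) (-1)) a) ! j = map (\<lambda>k. 0\<^sub>m k k) ns ! j"
      using a matrix_tuplesD(2)[OF a j] by (simp only: nth matrix_tuples_closed) (auto intro!: eq_matI)
  qed (use a in simp_all)
  show "map2 (+) a (map (\<lambda>k. 0\<^sub>m k k) ns) = a"
    by (rule eqI) (use a in \<open>simp_all add: nth matrix_tuplesD right_add_zero_mat[OF matrix_tuplesD(2)]\<close>)
  show "map ((\<cdot>\<^sub>m) (x * y)) a = map ((\<cdot>\<^sub>m) x) (map ((\<cdot>\<^sub>m) y) a)"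
    by (rule eqI) (use a in \<open>auto simp: matrix_tuplesD simp del: map_map intro!: eq_matI\<close>)
  show "map ((\<cdot>\<^sub>m) (1 :: complex)) a = a"
    by (rule eqI) (use a in \<open>auto simp: matrix_tuplesD simp del: map_map intro!: eq_matI\<close>)
  show "map ((\<cdot>\<^sub>m) (x + y)) a = map2 (+) (map ((\<cdot>\<^sub>m) x) a) (map ((\<cdot>\<^sub>m) y) a)"
    by (rule eqI) (use a in \<open>auto simp: matrix_tuplesD algebra_simps simp del: map_map intro!: eq_matI\<close>)
  assume b: "b \<in> matrix_tuples ns"
  show "map2 (+) a b = map2 (+) b a"
  proof (rule eqI)
    fix j assume j: "j < length ns"
    then show "map2 (+) a b ! j = map2 (+) b a ! j"
      using comm_add_mat[OF matrix_tuplesD(2)[OF a j] matrix_tuplesD(2)[OF b j]] a b by (simp add: nth)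
  qed (use a b in simp_all)
  show "map ((\<cdot>\<^sub>m) x) (map2 (+) a b) = map2 (+) (map ((\<cdot>\<^sub>m) x) a) (map ((\<cdot>\<^sub>m) x) b)"
  proof (rule eqI)
    fix j assume j: "j < length ns"
    then show "map ((\<cdot>\<^sub>m) x) (map2 (+) a b) ! j = map2 (+) (map ((\<cdot>\<^sub>m) x) a) (map ((\<cdot>\<^sub>m) x) b) ! j"
      using add_smult_distrib_left_mat[OF matrix_tuplesD(2)[OF a j] matrix_tuplesD(2)[OF b j]] a b
      by (simp add: matrix_tuplesD)
  qed (use a b in \<open>simp_all del: map_map\<close>)
  assume c: "c \<in> matrix_tuples ns"
  show "map2 (+) (map2 (+) a b) c = map2 (+) a (map2 (+) b c)"
  proof (rule eqI)
    fix j assume j: "j < length ns"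
    then show "map2 (+) (map2 (+) a b) c ! j = map2 (+) a (map2 (+) b c) ! j"
      using assoc_add_mat[OF matrix_tuplesD(2)[OF a j] matrix_tuplesD(2)[OF b j] matrix_tuplesD(2)[OF c j]] a b c
      by (simp add: matrix_tuplesD)
  qed (use a b c in simp_all)
qed simp_all

lemma fd_star_algebra_matrix_alg: "fd_star_algebra (matrix_alg ns)"
proof -
  interpret module "class_ring :: complex ring" "matrix_alg ns" by (rule module_matrix_alg)
  interpret vectorspace "class_ring :: complex ring" "matrix_alg ns"
    by (intro vectorspace.intro module_axioms class_field)
  note nth = nth_map2_tuples[where ns = ns] nth_map_tuples[where ns = ns]
  note eqI = matrix_tuples_eqI[where ns = ns]
  note D = matrix_tuplesD(2)[where ns = ns]
  have ring: "ring (matrix_alg ns)"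
  proof (rule ringI)
    show "abelian_group (matrix_alg ns)" ..
    show "monoid (matrix_alg ns)"
    proof (rule monoidI, unfold matrix_alg_simps)
      fix a b c assume a: "a \<in> matrix_tuples ns" and b: "b \<in> matrix_tuples ns" and c: "c \<in> matrix_tuples ns"
      show "map2 (*) (map2 (*) a b) c = map2 (*) a (map2 (*) b c)"
        by (rule eqI) (use a b c in \<open>simp_all add: nth assoc_mult_mat[OF D D D]\<close>)
    qed (auto intro!: eqI simp: nth left_mult_one_mat[OF D] right_mult_one_mat[OF D])
    fix a b c assume "a \<in> carrier (matrix_alg ns)" "b \<in> carrier (matrix_alg ns)" "c \<in> carrier (matrix_alg ns)"
    then have a: "a \<in> matrix_tuples ns" and b: "b \<in> matrix_tuples ns" and c: "c \<in> matrix_tuples ns" by auto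
    show "(a \<oplus>\<^bsub>matrix_alg ns\<^esub> b) \<otimes>\<^bsub>matrix_alg ns\<^esub> c =
        a \<otimes>\<^bsub>matrix_alg ns\<^esub> c \<oplus>\<^bsub>matrix_alg ns\<^esub> b \<otimes>\<^bsub>matrix_alg ns\<^esub> c"
      unfolding matrix_alg_simps
      by (rule eqI) (use a b c in \<open>simp_all add: nth add_mult_distrib_mat[OF D D D]\<close>)
    show "c \<otimes>\<^bsub>matrix_alg ns\<^esub> (a \<oplus>\<^bsub>matrix_alg ns\<^esub> b) =
        c \<otimes>\<^bsub>matrix_alg ns\<^esub> a \<oplus>\<^bsub>matrix_alg ns\<^esub> c \<otimes>\<^bsub>matrix_alg ns\<^esub> b"
      unfolding matrix_alg_simps
      by (rule eqI) (use a b c in \<open>simp_all add: nth mult_add_distrib_mat[OF D D D]\<close>)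
  qed
  have fin_dim: "fin_dim"
  proof -
    define B where "B = (\<lambda>(i, k, l). matrix_unit ns i k l) `
      Sigma {..<length ns} (\<lambda>i. {..<ns ! i} \<times> {..<ns ! i})"
    have B: "finite B" "B \<subseteq> carrier (matrix_alg ns)"
      by (auto simp: B_def)
    interpret span: submodule "class_ring :: complex ring" "span B" "matrix_alg ns"
      by (rule span_is_submodule[OF B(2)])
    have "a \<in> span B" if "a \<in> matrix_tuples ns" for a
      using that
    proof (induction rule: matrix_tuples_span)
      case zero
      show ?case using span.zero_closed by simp
    next
      case (add a b)
      then show ?case using span.m_closed by simp
    next
      case (smult c a)
      then show ?case using span.smult_closed[of c a] by simp
    next
      case (unit i k l)
      then have "matrix_unit ns i k l \<in> B" by (force simp: B_def)
      then show ?case using in_own_span[OF B(2)] by auto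
    qed
    then have "span B = carrier (matrix_alg ns)"
      using span_is_subset2[OF B(2)] by auto
    then show ?thesis using B by (auto simp: fin_dim_def)
  qed
  show ?thesis
  proof (intro fd_star_algebra.intro fd_star_algebra_axioms.intro ring vectorspace_axioms fin_dim, unfold matrix_alg_simps)
    fix a b :: "complex mat list" and c :: complex
    assume a: "a \<in> matrix_tuples ns"
    show "map mat_adjoint a \<in> matrix_tuples ns" using a by simp
    show "map mat_adjoint (map mat_adjoint a) = a" by (simp add: o_def)
    show "map mat_adjoint (map ((\<cdot>\<^sub>m) c) a) = map ((\<cdot>\<^sub>m) (cnj c)) (map mat_adjoint a)"
      by (simp add: o_def mat_adjoint_smult)
    assume b: "b \<in> matrix_tuples ns"
    show "map2 (*) (map ((\<cdot>\<^sub>m) c) a) b = map ((\<cdot>\<^sub>m) c) (map2 (*) a b)"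
      by (rule eqI) (use a b in \<open>simp_all add: nth mult_smult_assoc_mat[OF D D] del: map_map\<close>)
    show "map2 (*) a (map ((\<cdot>\<^sub>m) c) b) = map ((\<cdot>\<^sub>m) c) (map2 (*) a b)"
      by (rule eqI) (use a b in \<open>simp_all add: nth mult_smult_distrib[OF D D] del: map_map\<close>)
    show "map mat_adjoint (map2 (+) a b) = map2 (+) (map mat_adjoint a) (map mat_adjoint b)"
      by (rule eqI) (use a b in \<open>simp_all add: nth mat_adjoint_add[OF D D] del: map_map\<close>)
    show "map mat_adjoint (map2 (*) a b) = map2 (*) (map mat_adjoint b) (map mat_adjoint a)"
      by (rule eqI) (use a b in \<open>simp_all add: nth mat_adjoint_mult[OF D D] del: map_map\<close>)
  qed
qed

text \<open>Finite dimension is transported along the identity map from the space of vectors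
  without inner product.\<close>

lemma fd_hilbert_std_hilb: "fd_hilbert (std_hilb d)"
proof -
  interpret V: vec_space "TYPE(complex)" d .
  have module: "Module.module (class_ring :: complex ring) (std_hilb d)"
  proof (rule module_criteria, unfold std_hilb_simps ring.simps monoid.simps partial_object.simps, safe)
    show "cring (class_ring :: complex ring)" ..
    fix v :: "complex vec" assume v: "v \<in> carrier_vec d"
    show "\<exists>w\<in>carrier_vec d. v + w = 0\<^sub>v d"
      by (rule bexI[of _ "- v"]) (use v in auto)
  qed (auto simp: comm_add_vec[where n = d] assoc_add_vec[where n = d] smult_smult_assoc
      add_smult_distrib_vec smult_add_distrib_vec[where n = d])
  interpret vectorspace "class_ring :: complex ring" "std_hilb d"
    by (intro vectorspace.intro module class_field)
  interpret linear_map "class_ring :: complex ring" "module_vec TYPE(complex) d" "std_hilb d" id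
    by (intro linear_map.intro mod_hom.intro mod_hom_axioms.intro module V.vectorspace_axioms vectorspace_axioms
        V.module_axioms) (simp add: module_hom_def module_vec_def)
  have fin_dim: "fin_dim"
    by (rule surj_fin_dim[OF V.fin_dim]) (simp add: module_vec_def)
  show ?thesis
  proof (intro fd_hilbert.intro fd_hilbert_axioms.intro vectorspace_axioms fin_dim, unfold std_hilb_simps)
    fix u v w :: "complex vec" and c :: complex
    assume v: "v \<in> carrier_vec d"
    show "Im (v \<bullet>c v) = 0 \<and> 0 < Re (v \<bullet>c v)" if "v \<noteq> 0\<^sub>v d"
    proof -
      have "v \<bullet>c v > 0" using v that by simp
      then show ?thesis by (auto simp: less_complex_def)
    qed
    assume w: "w \<in> carrier_vec d"
    show "(c \<cdot>\<^sub>v v) \<bullet>c w = c * (v \<bullet>c w)" using v w by simp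
    show "w \<bullet>c v = cnj (v \<bullet>c w)"
      using v w by (auto simp: scalar_prod_def ac_simps)
    show "(u + v) \<bullet>c w = u \<bullet>c w + v \<bullet>c w" if "u \<in> carrier_vec d"
      using v w that by (simp add: add_scalar_prod_distrib[where n = d])
  qed
qed

lemma (in matrix_rep) is_star_action:
  "is_star_action (matrix_alg ns) (\<lambda>a v. \<psi> a *\<^sub>v v) (std_hilb d)"
proof -
  have "(\<psi> a *\<^sub>v v) \<bullet>c w = v \<bullet>c (\<psi> (map mat_adjoint a) *\<^sub>v w)"
    if "a \<in> matrix_tuples ns" "v \<in> carrier_vec d" "w \<in> carrier_vec d" for a v w
    using inner_mult_mat_vec[OF carrier[OF that(1)] that(2,3)] that by (simp add: adjoint)
  moreover have "\<psi> (map2 (+) a b) *\<^sub>v v = \<psi> a *\<^sub>v v + \<psi> b *\<^sub>v v"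
    "\<psi> (map2 (*) a b) *\<^sub>v v = \<psi> a *\<^sub>v (\<psi> b *\<^sub>v v)"
    if "a \<in> matrix_tuples ns" "b \<in> matrix_tuples ns" "v \<in> carrier_vec d" for a b v
    using that by (simp_all add: add mult add_mult_distrib_mat_vec[OF carrier carrier] assoc_mult_mat_vec[OF carrier carrier])
  moreover have "\<psi> (map ((\<cdot>\<^sub>m) c) a) *\<^sub>v v = c \<cdot>\<^sub>v (\<psi> a *\<^sub>v v)"
    if "a \<in> matrix_tuples ns" "v \<in> carrier_vec d" for a v c
    using that by (simp add: smult smult_mat_mult_vec[OF carrier])
  moreover have "(\<lambda>v. \<psi> a *\<^sub>v v) \<in> module_hom (class_ring :: complex ring) (std_hilb d) (std_hilb d)"
    if "a \<in> matrix_tuples ns" for a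
    using that carrier[OF that]
    by (auto simp: module_hom_def mult_add_distrib_mat_vec[OF carrier[OF that]] mult_mat_vec[OF carrier[OF that]])
  ultimately show ?thesis
    by (simp add: is_star_action_def one)
qed

lemma std_action_eq: "std_action rs a v = multiplicity_sum rs a *\<^sub>v v"
  by (simp add: std_action_def multiplicity_sum_def)

lemma X_obj_dim:
  "length rs = length ns \<Longrightarrow> sum_list (map2 (*) rs ns) = (\<Sum>i<length ns. rs ! i * ns ! i)"
  by (simp add: sum_list_sum_nth atLeast0LessThan)

lemma matrix_rep_std:
  "length rs = length ns \<Longrightarrow> matrix_rep ns (sum_list (map2 (*) rs ns)) (multiplicity_sum rs)"
  by (simp add: X_obj_dim matrix_rep_multiplicity_sum)

lemma X_obj_prespectral:
  assumes "length rs = length ns" "\<forall>r\<in>set rs. 0 < r"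
  shows "prespectral_triple (X_obj ns rs)"
proof -
  interpret matrix_rep ns "sum_list (map2 (*) rs ns)" "multiplicity_sum rs"
    by (rule matrix_rep_std[OF assms(1)])
  have "std_action rs = (\<lambda>a v. multiplicity_sum rs a *\<^sub>v v)"
    by (simp add: fun_eq_iff std_action_eq)
  moreover have "a = b" if ab: "a \<in> matrix_tuples ns" "b \<in> matrix_tuples ns"
    and eq: "\<forall>v\<in>carrier_vec (sum_list (map2 (*) rs ns)). multiplicity_sum rs a *\<^sub>v v = multiplicity_sum rs b *\<^sub>v v" for a b
  proof -
    have "multiplicity_sum rs a = multiplicity_sum rs b"
      using eq by (intro mat_eq_if_mult_vec_eq[OF carrier[OF ab(1)] carrier[OF ab(2)]]) simp
    then show ?thesis using multiplicity_sum_inj[OF assms(1) ab assms(2)] by simp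
  qed
  ultimately show ?thesis
    using is_star_action
    by (simp add: prespectral_triple_def X_obj_def fd_star_algebra_matrix_alg fd_hilbert_std_hilb)
qed


section \<open>Algebra maps and their unitary implementations\<close>

lemma star_alg_hom_rep:
  assumes \<phi>: "\<phi> \<in> star_alg_hom (matrix_alg ns) (matrix_alg ms)" and "matrix_rep ms d \<psi>"
  shows "matrix_rep ns d (\<lambda>a. \<psi> (\<phi> a))"
proof -
  interpret \<psi>: matrix_rep ms d \<psi> by fact
  have closed: "\<phi> a \<in> matrix_tuples ms" if "a \<in> matrix_tuples ns" for a
    using \<phi> that by (auto simp: star_alg_hom_def Ring.ring_hom_def)
  show ?thesis
  proof
    fix a b :: "complex mat list" and c :: complex
    assume a: "a \<in> matrix_tuples ns"
    show "\<psi> (\<phi> a) \<in> carrier_mat d d" by (rule \<psi>.carrier[OF closed[OF a]])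
    show "\<psi> (\<phi> (map ((\<cdot>\<^sub>m) c) a)) = c \<cdot>\<^sub>m \<psi> (\<phi> a)"
      using \<phi> a by (simp add: star_alg_hom_def \<psi>.smult[OF closed[OF a]])
    show "\<psi> (\<phi> (map mat_adjoint a)) = mat_adjoint (\<psi> (\<phi> a))"
      using \<phi> a by (simp add: star_alg_hom_def \<psi>.adjoint[OF closed[OF a]])
    assume b: "b \<in> matrix_tuples ns"
    show "\<psi> (\<phi> (map2 (+) a b)) = \<psi> (\<phi> a) + \<psi> (\<phi> b)"
      using \<phi> a b by (simp add: star_alg_hom_def Ring.ring_hom_def \<psi>.add[OF closed[OF a] closed[OF b]])
    show "\<psi> (\<phi> (map2 (*) a b)) = \<psi> (\<phi> a) * \<psi> (\<phi> b)"
      using \<phi> a b by (simp add: star_alg_hom_def Ring.ring_hom_def \<psi>.mult[OF closed[OF a] closed[OF b]])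
  next
    show "\<psi> (\<phi> (map 1\<^sub>m ns)) = 1\<^sub>m d"
      using \<phi> by (simp add: star_alg_hom_def Ring.ring_hom_def \<psi>.one)
  qed
qed

lemma matrix_rep_nth: "j < length ms \<Longrightarrow> matrix_rep ms (ms ! j) (\<lambda>a. a ! j)"
  by unfold_locales (simp_all add: matrix_tuplesD)

lemma star_alg_homI:
  assumes closed: "\<And>a. a \<in> matrix_tuples ns \<Longrightarrow> length (\<phi> a) = length ms"
    and rep: "\<And>j. j < length ms \<Longrightarrow> matrix_rep ns (ms ! j) (\<lambda>a. \<phi> a ! j)"
  shows "\<phi> \<in> star_alg_hom (matrix_alg ns) (matrix_alg ms)"
proof -
  have tup: "\<phi> a \<in> matrix_tuples ms" if "a \<in> matrix_tuples ns" for a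
    using closed[OF that] matrix_rep.carrier[OF rep that] by (simp add: matrix_tuples_def)
  note simps = matrix_rep.add[OF rep] matrix_rep.mult[OF rep] matrix_rep.smult[OF rep]
    matrix_rep.adjoint[OF rep] matrix_rep.one[OF rep] nth_map2_tuples[where ns = ms] nth_map_tuples[where ns = ms]
  have "\<phi> (map2 (+) a b) = map2 (+) (\<phi> a) (\<phi> b)" "\<phi> (map2 (*) a b) = map2 (*) (\<phi> a) (\<phi> b)"
    if "a \<in> matrix_tuples ns" "b \<in> matrix_tuples ns" for a b
    by (rule matrix_tuples_eqI[where ns = ms]; use that in \<open>simp add: tup simps\<close>)+
  moreover have "\<phi> (map mat_adjoint a) = map mat_adjoint (\<phi> a)" "\<phi> (map ((\<cdot>\<^sub>m) c) a) = map ((\<cdot>\<^sub>m) c) (\<phi> a)"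
    if "a \<in> matrix_tuples ns" for a c
    by (rule matrix_tuples_eqI[where ns = ms]; use that in \<open>simp add: tup simps\<close>)+
  moreover have "\<phi> (map 1\<^sub>m ns) = map 1\<^sub>m ms"
    by (rule matrix_tuples_eqI[where ns = ms]) (simp_all add: tup simps)
  ultimately show ?thesis
    using tup by (simp add: star_alg_hom_def Ring.ring_hom_def)
qed

lemma matrix_rep_conj:
  assumes "matrix_rep ns d \<psi>" and U: "U \<in> unitary_group d"
  shows "matrix_rep ns d (\<lambda>a. U * \<psi> a * mat_adjoint U)"
proof -
  interpret matrix_rep ns d \<psi> by fact
  have UC: "U \<in> carrier_mat d d" "mat_adjoint U \<in> carrier_mat d d"
    and UU: "U * mat_adjoint U = 1\<^sub>m d" "mat_adjoint U * U = 1\<^sub>m d"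
    using U by (auto simp: unitary_group_def)
  have U\<psi>: "U * \<psi> a \<in> carrier_mat d d" if "a \<in> matrix_tuples ns" for a
    using UC carrier[OF that] by simp
  show ?thesis
  proof
    fix a b :: "complex mat list" and c :: complex
    assume a: "a \<in> matrix_tuples ns"
    note ca = carrier[OF a]
    show "U * \<psi> a * mat_adjoint U \<in> carrier_mat d d" by (rule mult_carrier_mat[OF U\<psi>[OF a] UC(2)])
    show "U * \<psi> (map ((\<cdot>\<^sub>m) c) a) * mat_adjoint U = c \<cdot>\<^sub>m (U * \<psi> a * mat_adjoint U)"
      by (simp add: smult[OF a] mult_smult_distrib[OF UC(1) ca] mult_smult_assoc_mat[OF U\<psi>[OF a] UC(2)])
    show "U * \<psi> (map mat_adjoint a) * mat_adjoint U = mat_adjoint (U * \<psi> a * mat_adjoint U)"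
      using ca by (simp add: adjoint[OF a] mat_adjoint_mult[OF U\<psi>[OF a] UC(2)] mat_adjoint_mult[OF UC(1) ca]
          assoc_mult_mat[OF UC(1) mat_adjoint_carrier[OF ca] UC(2)])
    assume b: "b \<in> matrix_tuples ns"
    note cb = carrier[OF b]
    show "U * \<psi> (map2 (+) a b) * mat_adjoint U = U * \<psi> a * mat_adjoint U + U * \<psi> b * mat_adjoint U"
      by (simp add: add[OF a b] mult_add_distrib_mat[OF UC(1) ca cb] add_mult_distrib_mat[OF U\<psi>[OF a] U\<psi>[OF b] UC(2)])
    have "(U * \<psi> a * mat_adjoint U) * (U * \<psi> b * mat_adjoint U) =
        U * \<psi> a * (mat_adjoint U * (U * \<psi> b * mat_adjoint U))"
      using UC ca cb by (intro assoc_mult_mat) auto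
    also have "mat_adjoint U * (U * \<psi> b * mat_adjoint U) = mat_adjoint U * (U * (\<psi> b * mat_adjoint U))"
      using UC cb by (simp add: assoc_mult_mat[OF UC(1) cb UC(2)])
    also have "\<dots> = (mat_adjoint U * U) * (\<psi> b * mat_adjoint U)"
      using UC cb by (intro assoc_mult_mat[symmetric]) auto
    also have "U * \<psi> a * ((mat_adjoint U * U) * (\<psi> b * mat_adjoint U)) = U * \<psi> a * (\<psi> b * mat_adjoint U)"
      using UU UC cb by simp
    also have "\<dots> = U * \<psi> a * \<psi> b * mat_adjoint U"
      using assoc_mult_mat[OF U\<psi>[OF a] cb UC(2)] by simp
    also have "\<dots> = U * (\<psi> a * \<psi> b) * mat_adjoint U"
      using assoc_mult_mat[OF UC(1) ca cb] by simp
    finally show "U * \<psi> (map2 (*) a b) * mat_adjoint U = (U * \<psi> a * mat_adjoint U) * (U * \<psi> b * mat_adjoint U)"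
      by (simp add: mult[OF a b])
  next
    show "U * \<psi> (map 1\<^sub>m ns) * mat_adjoint U = 1\<^sub>m d" using UC UU by (simp add: one)
  qed
qed

text \<open>This makes the adjoint, which is defined by a description operator, well defined.\<close>

lemma (in fd_hilbert) nondegenerate:
  assumes v: "v \<in> carrier H" and w: "w \<in> carrier H"
    and eq: "\<And>u. u \<in> carrier H \<Longrightarrow> inner H u v = inner H u w"
  shows "v = w"
proof -
  define z where "z = v \<oplus>\<^bsub>H\<^esub> (-1) \<odot>\<^bsub>H\<^esub> w"
  have mw: "(-1) \<odot>\<^bsub>H\<^esub> w \<in> carrier H" using w by (rule vs.smult_closed[rotated]) simp
  have z: "z \<in> carrier H" using v mw by (simp add: z_def)
  have "inner H z z = inner H v z - inner H w z"
    using inner_add[OF v mw z] inner_smult[OF w z, of "-1"] by (simp add: z_def)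
  also have "\<dots> = 0"
    using eq[OF z] inner_cnj[OF z v] inner_cnj[OF z w] by simp
  finally have "z = \<zero>\<^bsub>H\<^esub>" using inner_pos[OF z] by force
  then have "v = \<ominus>\<^bsub>H\<^esub> ((-1) \<odot>\<^bsub>H\<^esub> w)"
    using vs.minus_equality[OF _ mw v] by (simp add: z_def)
  also have "(-1) \<odot>\<^bsub>H\<^esub> w = \<ominus>\<^bsub>H\<^esub> w"
    using vs.smult_minus_1[OF w] by (simp add: class_ring_simps)
  finally show ?thesis using w by simp
qed

lemma adjoint_map_unitary:
  assumes "fd_hilbert H" and L: "L \<in> unitary_maps H K" and v: "v \<in> carrier H"
  shows "adjoint_map H K L (L v) = v"
proof -
  have "L v \<in> carrier K" "\<And>u. u \<in> carrier H \<Longrightarrow> inner K (L u) (L v) = inner H u v"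
    using L v by (auto simp: unitary_maps_def dest: bij_betwE)
  then show ?thesis
    using v fd_hilbert.nondegenerate[OF assms(1)]
    by (auto simp: adjoint_map_def intro!: the_equality)
qed

text \<open>For unitary \<open>L\<close> the adjoint is the inverse, so the relation \<open>\<mu>(\<phi>(a)) = L \<lambda>(a) L\<^sup>*\<close> says that \<open>L\<close>
  intertwines the two actions. Intertwiners are easier to compose.\<close>

lemma pS_pairs_iff:
  assumes "fd_hilbert H"
  shows "(\<phi>, L) \<in> pS_pairs (A, lam, H) (B, mu, K) \<longleftrightarrow>
    \<phi> \<in> star_alg_hom A B \<and> \<phi> \<in> extensional (carrier A) \<and> L \<in> unitary_maps H K \<and> L \<in> extensional (carrier H) \<and>
    (\<forall>a\<in>carrier A. \<forall>v\<in>carrier H. mu (\<phi> a) (L v) = L (lam a v))"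
proof -
  have "(\<forall>w\<in>carrier K. mu (\<phi> a) w = L (lam a (adjoint_map H K L w))) \<longleftrightarrow>
      (\<forall>v\<in>carrier H. mu (\<phi> a) (L v) = L (lam a v))" if L: "L \<in> unitary_maps H K" for a
  proof -
    have "carrier K = L ` carrier H"
      using L by (auto simp: unitary_maps_def bij_betw_def)
    then show ?thesis
      using adjoint_map_unitary[OF assms L] by simp
  qed
  then show ?thesis by (auto simp: pS_pairs_def)
qed

lemma linear_isometry_matrix:
  assumes L: "L \<in> unitary_maps (std_hilb d) (std_hilb d')"
  shows "\<exists>M\<in>carrier_mat d' d. mat_adjoint M * M = 1\<^sub>m d \<and> M * mat_adjoint M = 1\<^sub>m d' \<and>
    (\<forall>v\<in>carrier_vec d. L v = M *\<^sub>v v)"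
proof -
  have "\<exists>M\<in>carrier_mat d' d. \<forall>v\<in>carrier_vec d. L v = M *\<^sub>v v"
    using L by (intro linear_map_matrix) (auto simp: unitary_maps_def module_hom_def)
  then obtain M where M: "M \<in> carrier_mat d' d" "\<And>v. v \<in> carrier_vec d \<Longrightarrow> L v = M *\<^sub>v v"
    by blast
  note Ma = mat_adjoint_carrier[OF M(1)]
  have 1: "mat_adjoint M * M = 1\<^sub>m d"
  proof (rule mat_eq_if_inner_eq)
    fix x y :: "complex vec" assume x: "x \<in> carrier_vec d" and y: "y \<in> carrier_vec d"
    have "((mat_adjoint M * M) *\<^sub>v x) \<bullet>c y = (M *\<^sub>v x) \<bullet>c (M *\<^sub>v y)"
      using inner_mult_mat_vec[OF Ma, of "M *\<^sub>v x" y] M x y by (simp add: assoc_mult_mat_vec[OF Ma M(1)])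
    also have "\<dots> = x \<bullet>c y" using L M(2) x y by (simp add: unitary_maps_def)
    finally show "((mat_adjoint M * M) *\<^sub>v x) \<bullet>c y = (1\<^sub>m d *\<^sub>v x) \<bullet>c y" using x by simp
  qed (use M Ma in auto)
  have 2: "M * mat_adjoint M = 1\<^sub>m d'"
  proof (rule mat_eq_if_mult_vec_eq)
    fix w :: "complex vec" assume "w \<in> carrier_vec d'"
    then have "w \<in> L ` carrier_vec d" using L by (simp add: unitary_maps_def bij_betw_def)
    then obtain v where v: "v \<in> carrier_vec d" "w = M *\<^sub>v v" using M(2) by blast
    have "(M * mat_adjoint M) *\<^sub>v w = M *\<^sub>v ((mat_adjoint M * M) *\<^sub>v v)"
      using v M Ma by (simp add: assoc_mult_mat_vec[OF M(1) Ma] assoc_mult_mat_vec[OF Ma M(1)])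
    then show "(M * mat_adjoint M) *\<^sub>v w = 1\<^sub>m d' *\<^sub>v w" using 1 v M by simp
  qed (use M Ma in auto)
  from 1 2 M show ?thesis by blast
qed

lemma unitary_matrix_map:
  assumes U: "U \<in> unitary_group d"
  shows "(\<lambda>v\<in>carrier_vec d. U *\<^sub>v v) \<in> unitary_maps (std_hilb d) (std_hilb d)"
proof -
  have UC: "U \<in> carrier_mat d d" "mat_adjoint U \<in> carrier_mat d d"
    and UU: "U * mat_adjoint U = 1\<^sub>m d" "mat_adjoint U * U = 1\<^sub>m d"
    using U by (auto simp: unitary_group_def)
  have inv: "mat_adjoint U *\<^sub>v (U *\<^sub>v v) = v" "U *\<^sub>v (mat_adjoint U *\<^sub>v v) = v" if "v \<in> carrier_vec d" for v
    using that UU assoc_mult_mat_vec[OF UC that] assoc_mult_mat_vec[OF UC(2,1) that] by simp_all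
  have "bij_betw (\<lambda>v\<in>carrier_vec d. U *\<^sub>v v) (carrier_vec d) (carrier_vec d)"
    by (rule bij_betw_byWitness[where f' = "\<lambda>v. mat_adjoint U *\<^sub>v v"]) (use mult_mat_vec_carrier[OF UC(1)] mult_mat_vec_carrier[OF UC(2)] in \<open>auto simp: inv\<close>)
  moreover have "(U *\<^sub>v v) \<bullet>c (U *\<^sub>v w) = v \<bullet>c w" if "v \<in> carrier_vec d" "w \<in> carrier_vec d" for v w
    using that UC inner_mult_mat_vec[OF UC(1), of v "U *\<^sub>v w"] by (simp add: inv)
  ultimately show ?thesis
    using UC by (simp add: unitary_maps_def module_hom_def mult_add_distrib_mat_vec[OF UC(1)] mult_mat_vec[OF UC(1)])
qed

text \<open>The algebra maps that some unitary implements, that is, those that underlie a morphism.\<close>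

definition alg_maps :: "('a, 'h) triple \<Rightarrow> ('b, 'k) triple \<Rightarrow> ('a \<Rightarrow> 'b) set" where
  "alg_maps X Y = fst ` pS_pairs X Y"

text \<open>A unitary implementing \<open>\<phi>\<close> is a unitary equivalence between two representations of the source algebra:
  the one on its own Hilbert space and the one that \<open>\<phi>\<close> induces on the target. Conjugate matrices
  have equal traces, so equivalent representations have equal multiplicities. Conversely a
  representation is equivalent to the standard one with the same multiplicities.\<close>

lemma alg_maps_X_obj_iff:
  assumes ns: "\<forall>k\<in>set ns. 0 < k" and rs: "length rs = length ns" and ss: "length ss = length ms"
  shows "\<phi> \<in> alg_maps (X_obj ns rs) (X_obj ms ss) \<longleftrightarrow>
    \<phi> \<in> star_alg_hom (matrix_alg ns) (matrix_alg ms) \<and> \<phi> \<in> extensional (matrix_tuples ns) \<and>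
    (\<forall>i<length ns. trace (multiplicity_sum ss (\<phi> (corner ns i))) = of_nat (rs ! i))"
    (is "?lhs \<longleftrightarrow> ?rhs")
proof
  let ?d = "sum_list (map2 (*) rs ns)" and ?d' = "sum_list (map2 (*) ss ms)"
  have iff: "(\<phi>, L) \<in> pS_pairs (X_obj ns rs) (X_obj ms ss) \<longleftrightarrow>
    \<phi> \<in> star_alg_hom (matrix_alg ns) (matrix_alg ms) \<and> \<phi> \<in> extensional (matrix_tuples ns) \<and>
    L \<in> unitary_maps (std_hilb ?d) (std_hilb ?d') \<and> L \<in> extensional (carrier_vec ?d) \<and>
    (\<forall>a\<in>matrix_tuples ns. \<forall>v\<in>carrier_vec ?d. multiplicity_sum ss (\<phi> a) *\<^sub>v L v = L (multiplicity_sum rs a *\<^sub>v v))" for L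
    unfolding X_obj_def by (simp add: pS_pairs_iff[OF fd_hilbert_std_hilb] std_action_eq)
  interpret X: matrix_rep ns ?d "multiplicity_sum rs" by (rule matrix_rep_std[OF rs])
  {
    assume ?lhs
    then obtain L where \<phi>: "\<phi> \<in> star_alg_hom (matrix_alg ns) (matrix_alg ms)" "\<phi> \<in> extensional (matrix_tuples ns)"
      and L: "L \<in> unitary_maps (std_hilb ?d) (std_hilb ?d')"
      and eq: "\<And>a v. a \<in> matrix_tuples ns \<Longrightarrow> v \<in> carrier_vec ?d \<Longrightarrow>
        multiplicity_sum ss (\<phi> a) *\<^sub>v L v = L (multiplicity_sum rs a *\<^sub>v v)"
      by (auto simp: alg_maps_def iff)
    interpret \<phi>: matrix_rep ns ?d' "\<lambda>a. multiplicity_sum ss (\<phi> a)"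
      by (rule star_alg_hom_rep[OF \<phi>(1) matrix_rep_std[OF ss]])
    from linear_isometry_matrix[OF L] obtain M where M: "M \<in> carrier_mat ?d' ?d"
      "mat_adjoint M * M = 1\<^sub>m ?d" "M * mat_adjoint M = 1\<^sub>m ?d'" "\<And>v. v \<in> carrier_vec ?d \<Longrightarrow> L v = M *\<^sub>v v"
      by blast
    have "trace (multiplicity_sum ss (\<phi> (corner ns i))) = of_nat (rs ! i)" if i: "i < length ns" for i
    proof -
      let ?a = "corner ns i"
      have a: "?a \<in> matrix_tuples ns" by simp
      have inter: "multiplicity_sum ss (\<phi> ?a) * M = M * multiplicity_sum rs ?a"
      proof (rule mat_eq_if_mult_vec_eq[of _ ?d' ?d])
        fix v :: "complex vec" assume v: "v \<in> carrier_vec ?d"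
        show "(multiplicity_sum ss (\<phi> ?a) * M) *\<^sub>v v = (M * multiplicity_sum rs ?a) *\<^sub>v v"
          using eq[OF a v] v X.carrier[OF a]
          by (simp add: M(4) assoc_mult_mat_vec[OF \<phi>.carrier[OF a] M(1)] assoc_mult_mat_vec[OF M(1) X.carrier[OF a]])
      qed (use M(1) X.carrier[OF a] \<phi>.carrier[OF a] in simp_all)
      have "multiplicity_sum ss (\<phi> ?a) = multiplicity_sum ss (\<phi> ?a) * M * mat_adjoint M"
        using assoc_mult_mat[OF \<phi>.carrier[OF a] M(1) mat_adjoint_carrier[OF M(1)]] M(3) \<phi>.carrier[OF a] by simp
      then have "trace (multiplicity_sum ss (\<phi> ?a)) = trace (M * multiplicity_sum rs ?a * mat_adjoint M)"
        by (simp add: inter)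
      also have "\<dots> = trace (multiplicity_sum rs ?a)"
        using M by (intro trace_conj[OF M(1) _ M(2) X.carrier[OF a]]) simp
      also have "\<dots> = of_nat (rs ! i)"
        using rs ns i by (intro trace_multiplicity_sum_corner) auto
      finally show ?thesis .
    qed
    with \<phi> show ?rhs by blast
  next
    assume r: ?rhs
    interpret \<phi>: matrix_rep ns ?d' "\<lambda>a. multiplicity_sum ss (\<phi> a)"
      by (rule star_alg_hom_rep[OF _ matrix_rep_std[OF ss]]) (use r in blast)
    from \<phi>.unitarily_standard[OF ns] obtain cs U where cs: "length cs = length ns" "?d' = (\<Sum>i<length ns. cs ! i * ns ! i)"
      "\<And>i. i < length ns \<Longrightarrow> trace (multiplicity_sum ss (\<phi> (corner ns i))) = of_nat (cs ! i)"
      and U: "U \<in> unitary_group ?d'"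
      "\<And>a. a \<in> matrix_tuples ns \<Longrightarrow> multiplicity_sum ss (\<phi> a) = U * multiplicity_sum cs a * mat_adjoint U"
      by blast
    have "cs = rs"
      using cs(1,3) r rs by (intro nth_equalityI) (auto simp: of_nat_eq_iff)
    then have d: "?d' = ?d" using cs(2) X_obj_dim[OF rs] by simp
    let ?L = "\<lambda>v\<in>carrier_vec ?d. U *\<^sub>v v"
    have UC: "U \<in> carrier_mat ?d ?d" "mat_adjoint U * U = 1\<^sub>m ?d"
      using U(1) unfolding d by (auto simp: unitary_group_def)
    note UaC = mat_adjoint_carrier[OF UC(1)]
    have "multiplicity_sum ss (\<phi> a) *\<^sub>v (U *\<^sub>v v) = U *\<^sub>v (multiplicity_sum rs a *\<^sub>v v)"
      if a: "a \<in> matrix_tuples ns" and v: "v \<in> carrier_vec ?d" for a v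
    proof -
      note Xa = X.carrier[OF a]
      have "multiplicity_sum ss (\<phi> a) * U = U * multiplicity_sum rs a * (mat_adjoint U * U)"
        using U(2)[OF a] \<open>cs = rs\<close> assoc_mult_mat[OF mult_carrier_mat[OF UC(1) Xa] UaC UC(1)] by simp
      also have "\<dots> = U * multiplicity_sum rs a"
        using UC Xa by simp
      finally have "(multiplicity_sum ss (\<phi> a) * U) *\<^sub>v v = (U * multiplicity_sum rs a) *\<^sub>v v"
        by simp
      then show ?thesis
        using v by (simp add: assoc_mult_mat_vec[OF \<phi>.carrier[OF a, unfolded d] UC(1)]
            assoc_mult_mat_vec[OF UC(1) Xa])
    qed
    then have "(\<phi>, ?L) \<in> pS_pairs (X_obj ns rs) (X_obj ms ss)"
      using r unitary_matrix_map[OF U(1)] mult_mat_vec_carrier[OF X.carrier] unfolding iff d by simp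
    then show ?lhs by (force simp: alg_maps_def)
  }
qed


section \<open>Bratteli diagrams parametrise algebra maps\<close>

text \<open>The algebra map \<open>a \<mapsto> u B(a) u\<^sup>*\<close> attached to one arc of a network.\<close>

definition diagram_map :: "nat list \<Rightarrow> nat mat \<Rightarrow> complex mat list \<Rightarrow> complex mat list \<Rightarrow> complex mat list" where
  "diagram_map ns C us = (\<lambda>a\<in>carrier (matrix_alg ns). conj_tuple us (block_embedding C a))"

lemma block_embedding_nth:
  assumes "j < dim_col C" "length a = dim_row C"
  shows "block_embedding C a ! j = multiplicity_sum (map (\<lambda>i. C $$ (i, j)) [0..<dim_row C]) a"
proof -
  have "map2 replicate (map (\<lambda>i. C $$ (i, j)) [0..<dim_row C]) a =
      map (\<lambda>i. replicate (C $$ (i, j)) (a ! i)) [0..<dim_row C]"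
    using assms by (intro nth_equalityI) auto
  then show ?thesis
    using assms by (simp add: block_embedding_def multiplicity_sum_def)
qed

lemma diagram_map_nth:
  assumes "C \<in> carrier_mat (length ns) (length ms)" "us \<in> unitary_tuples ms"
    "a \<in> matrix_tuples ns" "j < length ms"
  shows "diagram_map ns C us a ! j =
    us ! j * multiplicity_sum (map (\<lambda>i. C $$ (i, j)) [0..<length ns]) a * mat_adjoint (us ! j)"
proof -
  have "length (block_embedding C a) = length ms" using assms(1) by (simp add: block_embedding_def)
  then show ?thesis
    using assms block_embedding_nth[of j C a] matrix_tuplesD(1)[OF assms(3)]
    by (simp add: diagram_map_def conj_tuple_def unitary_tuples_def)
qed

text \<open>Conjugation does not change traces, so the entries of the diagram can be read off from the
  algebra map alone.\<close>

lemma trace_diagram_map: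
  assumes C: "C \<in> carrier_mat (length ns) (length ms)" and us: "us \<in> unitary_tuples ms"
    and dim: "\<And>j. j < length ms \<Longrightarrow> ms ! j = (\<Sum>i<length ns. C $$ (i, j) * ns ! i)"
    and i: "i < length ns" "0 < ns ! i" and j: "j < length ms"
  shows "trace (diagram_map ns C us (corner ns i) ! j) = of_nat (C $$ (i, j))"
proof -
  let ?c = "map (\<lambda>i. C $$ (i, j)) [0..<length ns]"
  have a: "corner ns i \<in> matrix_tuples ns" by simp
  have rep: "matrix_rep ns (ms ! j) (multiplicity_sum ?c)"
    using matrix_rep_multiplicity_sum[of ?c ns] dim[OF j] by simp
  have U: "us ! j \<in> carrier_mat (ms ! j) (ms ! j)" "mat_adjoint (us ! j) * us ! j = 1\<^sub>m (ms ! j)"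
    using us j by (auto simp: unitary_tuples_def unitary_group_def)
  have "trace (diagram_map ns C us (corner ns i) ! j) = trace (multiplicity_sum ?c (corner ns i))"
    unfolding diagram_map_nth[OF C us a j]
    by (rule trace_conj[OF U(1) mat_adjoint_carrier[OF U(1)] U(2) matrix_rep.carrier[OF rep a]])
  also have "\<dots> = of_nat (C $$ (i, j))"
    using i by (subst trace_multiplicity_sum_corner) auto
  finally show ?thesis .
qed

lemma matrix_rep_cong:
  assumes "matrix_rep ns d \<psi>" "\<And>a. a \<in> matrix_tuples ns \<Longrightarrow> \<psi>' a = \<psi> a"
  shows "matrix_rep ns d \<psi>'"
proof -
  interpret matrix_rep ns d \<psi> by fact
  show ?thesis
    by unfold_locales (simp_all add: assms(2) carrier add mult smult adjoint one)
qed

text \<open>The relation between the dimension vectors makes the blocks fit into the target algebra. The relation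
  between the multiplicity vectors is the trace condition for the existence of an implementing unitary.\<close>

lemma diagram_map_alg_map:
  assumes C: "C \<in> carrier_mat (length ns) (length ms)" and us: "us \<in> unitary_tuples ms"
    and pos: "\<forall>k\<in>set ns. 0 < k" and rs: "length rs = length ns" and ss: "length ss = length ms"
    and dim: "\<And>j. j < length ms \<Longrightarrow> ms ! j = (\<Sum>i<length ns. C $$ (i, j) * ns ! i)"
    and mult: "\<And>i. i < length ns \<Longrightarrow> rs ! i = (\<Sum>j<length ms. C $$ (i, j) * ss ! j)"
  shows "diagram_map ns C us \<in> alg_maps (X_obj ns rs) (X_obj ms ss)"
  unfolding alg_maps_X_obj_iff[OF pos rs ss]
proof (intro conjI allI impI)
  have len: "length (diagram_map ns C us a) = length ms" if "a \<in> matrix_tuples ns" for a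
    using C us that by (simp add: diagram_map_def conj_tuple_def block_embedding_def unitary_tuples_def)
  have rep: "matrix_rep ns (ms ! j) (\<lambda>a. diagram_map ns C us a ! j)" if j: "j < length ms" for j
  proof (rule matrix_rep_cong[OF matrix_rep_conj])
    show "us ! j \<in> unitary_group (ms ! j)" using us j by (simp add: unitary_tuples_def)
    show "matrix_rep ns (ms ! j) (multiplicity_sum (map (\<lambda>i. C $$ (i, j)) [0..<length ns]))"
      using matrix_rep_multiplicity_sum[of "map (\<lambda>i. C $$ (i, j)) [0..<length ns]" ns] dim[OF j] by simp
  qed (rule diagram_map_nth[OF C us _ j])
  show hom: "diagram_map ns C us \<in> star_alg_hom (matrix_alg ns) (matrix_alg ms)"
    by (rule star_alg_homI[OF len rep])
  show "diagram_map ns C us \<in> extensional (matrix_tuples ns)"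
    by (simp add: diagram_map_def)
  fix i assume i: "i < length ns"
  have img: "diagram_map ns C us (corner ns i) \<in> matrix_tuples ms"
    using hom by (simp add: star_alg_hom_def Ring.ring_hom_def Pi_iff)
  have "trace (multiplicity_sum ss (diagram_map ns C us (corner ns i))) =
      (\<Sum>j<length ms. of_nat (ss ! j) * of_nat (C $$ (i, j)))"
    using i pos by (simp add: trace_multiplicity_sum[OF ss img] trace_diagram_map[OF C us dim])
  also have "\<dots> = of_nat (\<Sum>j<length ms. C $$ (i, j) * ss ! j)"
    by (simp add: mult.commute)
  finally show "trace (multiplicity_sum ss (diagram_map ns C us (corner ns i))) = of_nat (rs ! i)"
    by (simp add: mult[OF i])
qed

text \<open>Each component of \<open>\<phi>\<close> is a representation on \<open>\<complex>\<^sup>k\<close> with \<open>k = m\<^sub>j\<close>; its multiplicities form column \<open>j\<close> of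
  the diagram.\<close>

lemma alg_map_diagram:
  assumes pos: "\<forall>k\<in>set ns. 0 < k" and rs: "length rs = length ns" and ss: "length ss = length ms"
    and \<phi>: "\<phi> \<in> alg_maps (X_obj ns rs) (X_obj ms ss)"
  shows "\<exists>C us. C \<in> carrier_mat (length ns) (length ms) \<and> us \<in> unitary_tuples ms \<and>
    (\<forall>j<length ms. ms ! j = (\<Sum>i<length ns. C $$ (i, j) * ns ! i)) \<and>
    (\<forall>i<length ns. rs ! i = (\<Sum>j<length ms. C $$ (i, j) * ss ! j)) \<and>
    \<phi> = diagram_map ns C us"
proof -
  have hom: "\<phi> \<in> star_alg_hom (matrix_alg ns) (matrix_alg ms)" and ext: "\<phi> \<in> extensional (matrix_tuples ns)"
    and tr: "\<And>i. i < length ns \<Longrightarrow> trace (multiplicity_sum ss (\<phi> (corner ns i))) = of_nat (rs ! i)"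
    using \<phi> unfolding alg_maps_X_obj_iff[OF pos rs ss] by blast+
  have img: "\<phi> a \<in> matrix_tuples ms" if "a \<in> matrix_tuples ns" for a
    using hom that by (auto simp: star_alg_hom_def Ring.ring_hom_def)
  have "\<forall>j\<in>{..<length ms}. \<exists>p. length (fst p) = length ns \<and> ms ! j = (\<Sum>i<length ns. fst p ! i * ns ! i) \<and>
    (\<forall>i<length ns. trace (\<phi> (corner ns i) ! j) = of_nat (fst p ! i)) \<and> snd p \<in> unitary_group (ms ! j) \<and>
    (\<forall>a\<in>matrix_tuples ns. \<phi> a ! j = snd p * multiplicity_sum (fst p) a * mat_adjoint (snd p))"
  proof
    fix j assume "j \<in> {..<length ms}"
    then interpret matrix_rep ns "ms ! j" "\<lambda>a. \<phi> a ! j"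
      by (intro star_alg_hom_rep[OF hom] matrix_rep_nth) simp
    from unitarily_standard[OF pos] show "\<exists>p. length (fst p) = length ns \<and> ms ! j = (\<Sum>i<length ns. fst p ! i * ns ! i) \<and>
      (\<forall>i<length ns. trace (\<phi> (corner ns i) ! j) = of_nat (fst p ! i)) \<and> snd p \<in> unitary_group (ms ! j) \<and>
      (\<forall>a\<in>matrix_tuples ns. \<phi> a ! j = snd p * multiplicity_sum (fst p) a * mat_adjoint (snd p))"
      by (simp only: split_paired_Ex fst_conv snd_conv)
  qed
  from bchoice[OF this, unfolded Ball_def lessThan_iff] obtain p where p: "\<And>j. j < length ms \<Longrightarrow> length (fst (p j)) = length ns"
    "\<And>j. j < length ms \<Longrightarrow> ms ! j = (\<Sum>i<length ns. fst (p j) ! i * ns ! i)"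
    "\<And>i j. j < length ms \<Longrightarrow> i < length ns \<Longrightarrow> trace (\<phi> (corner ns i) ! j) = of_nat (fst (p j) ! i)"
    "\<And>j. j < length ms \<Longrightarrow> snd (p j) \<in> unitary_group (ms ! j)"
    "\<And>j a. j < length ms \<Longrightarrow> a \<in> matrix_tuples ns \<Longrightarrow>
      \<phi> a ! j = snd (p j) * multiplicity_sum (fst (p j)) a * mat_adjoint (snd (p j))"
    by blast
  define C where "C = mat (length ns) (length ms) (\<lambda>(i, j). fst (p j) ! i)"
  define us where "us = map (\<lambda>j. snd (p j)) [0..<length ms]"
  have C: "C \<in> carrier_mat (length ns) (length ms)" by (simp add: C_def)
  have us: "us \<in> unitary_tuples ms" by (simp add: us_def unitary_tuples_def p(4))
  have col: "map (\<lambda>i. C $$ (i, j)) [0..<length ns] = fst (p j)" if "j < length ms" for j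
    using that p(1)[OF that] by (intro nth_equalityI) (simp_all add: C_def)
  have "of_nat (rs ! i) = (of_nat (\<Sum>j<length ms. C $$ (i, j) * ss ! j) :: complex)" if i: "i < length ns" for i
  proof -
    have "of_nat (rs ! i) = (\<Sum>j<length ms. of_nat (ss ! j) * trace (\<phi> (corner ns i) ! j))"
      using tr[OF i] by (simp add: trace_multiplicity_sum[OF ss img])
    also have "\<dots> = of_nat (\<Sum>j<length ms. C $$ (i, j) * ss ! j)"
      using i by (simp add: p(3) C_def mult.commute)
    finally show ?thesis .
  qed
  then have mult: "\<forall>i<length ns. rs ! i = (\<Sum>j<length ms. C $$ (i, j) * ss ! j)"
    using of_nat_eq_iff by blast
  have "\<phi> a = diagram_map ns C us a" if a: "a \<in> matrix_tuples ns" for a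
  proof (rule nth_equalityI)
    show "length (\<phi> a) = length (diagram_map ns C us a)"
      using matrix_tuplesD(1)[OF img[OF a]] C us a
      by (simp add: diagram_map_def conj_tuple_def block_embedding_def unitary_tuples_def)
    fix j assume "j < length (\<phi> a)"
    then have j: "j < length ms" using matrix_tuplesD(1)[OF img[OF a]] by simp
    show "\<phi> a ! j = diagram_map ns C us a ! j"
      using p(5)[OF j a] j by (simp add: diagram_map_nth[OF C us a j] col[OF j]) (simp add: us_def)
  qed
  then have "\<phi> = diagram_map ns C us"
    using ext by (intro extensionalityI[of _ "matrix_tuples ns"]) (simp_all add: diagram_map_def)
  moreover have "\<forall>j<length ms. ms ! j = (\<Sum>i<length ns. C $$ (i, j) * ns ! i)"
    using p(2) by (simp add: C_def)
  ultimately show ?thesis using C us mult by blast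
qed

section \<open>Morphisms are determined by their algebra maps\<close>

text \<open>The morphism with underlying algebra map \<open>\<phi>\<close>, which is empty unless \<open>\<phi>\<close> is implemented by a unitary.\<close>

definition alg_class :: "('a, 'h) triple \<Rightarrow> ('b, 'k) triple \<Rightarrow> ('a \<Rightarrow> 'b) \<Rightarrow> ('a, 'h, 'b, 'k) pS_mor" where
  "alg_class X Y \<phi> = {p \<in> pS_pairs X Y. fst p = \<phi>}"

lemma pS_rel_class:
  "(\<phi>, L) \<in> pS_pairs X Y \<Longrightarrow> pS_rel X Y `` {(\<phi>, L)} = alg_class X Y \<phi>"
  by (cases X; cases Y) (auto simp: pS_rel_def alg_class_def pS_pairs_def)

lemma fst_alg_class: "\<phi> \<in> alg_maps X Y \<Longrightarrow> fst ` alg_class X Y \<phi> = {\<phi>}"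
  by (force simp: alg_class_def alg_maps_def)

lemma pS_hom_eq: "pS_hom X Y = alg_class X Y ` alg_maps X Y"
proof -
  have "pS_hom X Y = (\<lambda>p. pS_rel X Y `` {p}) ` pS_pairs X Y"
    by (auto simp: pS_hom_def quotient_def)
  also have "\<dots> = (\<lambda>p. alg_class X Y (fst p)) ` pS_pairs X Y"
  proof (intro image_cong refl)
    fix p assume "p \<in> pS_pairs X Y"
    then show "pS_rel X Y `` {p} = alg_class X Y (fst p)"
      using pS_rel_class[of "fst p" "snd p" X Y] by simp
  qed
  finally show ?thesis by (simp add: alg_maps_def image_image)
qed

lemma pS_hom_cases:
  assumes "\<Phi> \<in> pS_hom X Y" "fst ` \<Phi> = {\<phi>}"
  shows "\<phi> \<in> alg_maps X Y" "\<Phi> = alg_class X Y \<phi>"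
  using assms by (auto simp: pS_hom_eq fst_alg_class)

lemma star_alg_hom_compose:
  assumes "fd_star_algebra A" "\<phi> \<in> star_alg_hom A B" "\<psi> \<in> star_alg_hom B C"
  shows "compose (carrier A) \<psi> \<phi> \<in> star_alg_hom A C"
proof -
  interpret fd_star_algebra A by fact
  have "c \<odot>\<^bsub>A\<^esub> a \<in> carrier A" if "a \<in> carrier A" for c a
    using vs.smult_closed[of c a] that by simp
  then show ?thesis
    using assms(2,3)
    by (auto simp: star_alg_hom_def Ring.ring_hom_def compose_def Pi_iff star_closed)
qed

lemma unitary_maps_compose:
  assumes "fd_hilbert H" "L \<in> unitary_maps H K" "M \<in> unitary_maps K J"
  shows "compose (carrier H) M L \<in> unitary_maps H J"
proof -
  interpret fd_hilbert H by fact
  have c: "c \<odot>\<^bsub>H\<^esub> v \<in> carrier H" if "v \<in> carrier H" for c v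
    using vs.smult_closed[of c v] that by simp
  have "bij_betw (compose (carrier H) M L) (carrier H) (carrier J)"
    using assms(2,3) by (auto simp: unitary_maps_def intro: bij_betw_compose)
  then show ?thesis
    using assms(2,3) c by (auto simp: unitary_maps_def module_hom_def compose_def Pi_iff)
qed

lemma pS_pairs_compose:
  assumes "prespectral_triple (A, lam, H)" "prespectral_triple (B, mu, K)"
    and \<phi>: "(\<phi>, L) \<in> pS_pairs (A, lam, H) (B, mu, K)"
    and \<psi>: "(\<psi>, M) \<in> pS_pairs (B, mu, K) (C, nu, J)"
  shows "(compose (carrier A) \<psi> \<phi>, compose (carrier H) M L) \<in> pS_pairs (A, lam, H) (C, nu, J)"
proof -
  have A: "fd_star_algebra A" and H: "fd_hilbert H" and K: "fd_hilbert K" and act: "is_star_action A lam H"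
    using assms(1,2) by (auto simp: prespectral_triple_def)
  have "lam a v \<in> carrier H" if "a \<in> carrier A" "v \<in> carrier H" for a v
    using act that by (auto simp: is_star_action_def module_hom_def)
  moreover have "\<phi> a \<in> carrier B" if "a \<in> carrier A" for a
    using \<phi> that unfolding pS_pairs_iff[OF H] by (auto simp: star_alg_hom_def Ring.ring_hom_def)
  moreover have "L v \<in> carrier K" if "v \<in> carrier H" for v
    using \<phi> that unfolding pS_pairs_iff[OF H] by (auto simp: unitary_maps_def module_hom_def)
  ultimately show ?thesis
    using \<phi> \<psi> unfolding pS_pairs_iff[OF H] pS_pairs_iff[OF K]
    by (auto simp: compose_eq star_alg_hom_compose[OF A] unitary_maps_compose[OF H])
qed

text \<open>All representatives of two composable morphisms have composites with the same algebra map, so the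
  union that defines the composite morphism consists of a single class.\<close>

lemma alg_maps_compose:
  assumes X: "prespectral_triple X" and Y: "prespectral_triple Y"
    and \<phi>: "\<phi> \<in> alg_maps X Y" and \<psi>: "\<psi> \<in> alg_maps Y Z"
  shows "compose (carrier (fst X)) \<psi> \<phi> \<in> alg_maps X Z"
    and "pS_comp X Z (alg_class Y Z \<psi>) (alg_class X Y \<phi>) = alg_class X Z (compose (carrier (fst X)) \<psi> \<phi>)"
proof -
  obtain A lam H where X': "X = (A, lam, H)" by (cases X)
  obtain B mu K where Y': "Y = (B, mu, K)" by (cases Y)
  obtain C nu J where Z': "Z = (C, nu, J)" by (cases Z)
  note comp = pS_pairs_compose[OF X[unfolded X'] Y[unfolded Y'], folded X' Y', of _ _ _ _ C nu J, folded Z']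
  obtain L M where L: "(\<phi>, L) \<in> pS_pairs X Y" and M: "(\<psi>, M) \<in> pS_pairs Y Z"
    using \<phi> \<psi> by (auto simp: alg_maps_def)
  from comp[OF L M] show "compose (carrier (fst X)) \<psi> \<phi> \<in> alg_maps X Z"
    by (force simp: alg_maps_def X')
  let ?K = "alg_class X Z (compose (carrier A) \<psi> \<phi>)"
  have const: "pS_rel X Z `` {(compose (carrier A) (fst q) (fst p), compose (carrier H) (snd q) (snd p))} = ?K"
    if "q \<in> alg_class Y Z \<psi>" "p \<in> alg_class X Y \<phi>" for q p
  proof -
    have "(\<phi>, snd p) \<in> pS_pairs X Y" "(\<psi>, snd q) \<in> pS_pairs Y Z" "fst p = \<phi>" "fst q = \<psi>"
      using that by (cases p; cases q; simp add: alg_class_def)+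
    then show ?thesis using pS_rel_class[OF comp] by simp
  qed
  have "pS_comp X Z (alg_class Y Z \<psi>) (alg_class X Y \<phi>) =
    (\<Union>q\<in>alg_class Y Z \<psi>. \<Union>p\<in>alg_class X Y \<phi>.
      pS_rel X Z `` {(compose (carrier A) (fst q) (fst p), compose (carrier H) (snd q) (snd p))})"
    by (simp add: pS_comp_def X' case_prod_beta)
  also have "\<dots> = (\<Union>q\<in>alg_class Y Z \<psi>. \<Union>p\<in>alg_class X Y \<phi>. ?K)"
    by (intro SUP_cong refl const)
  also have "\<dots> = ?K"
  proof -
    have "(\<psi>, M) \<in> alg_class Y Z \<psi>" "(\<phi>, L) \<in> alg_class X Y \<phi>"
      using L M by (auto simp: alg_class_def)
    then show ?thesis by auto
  qed
  finally show "pS_comp X Z (alg_class Y Z \<psi>) (alg_class X Y \<phi>) = alg_class X Z (compose (carrier (fst X)) \<psi> \<phi>)"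
    by (simp add: X')
qed

lemma alg_maps_id:
  assumes X: "prespectral_triple X"
  shows "(\<lambda>a\<in>carrier (fst X). a) \<in> alg_maps X X"
    and "pS_id X = alg_class X X (\<lambda>a\<in>carrier (fst X). a)"
proof -
  obtain A lam H where X': "X = (A, lam, H)" by (cases X)
  have A: "fd_star_algebra A" and H: "fd_hilbert H" and act: "is_star_action A lam H"
    using X by (auto simp: prespectral_triple_def X')
  interpret A: fd_star_algebra A by (rule A)
  interpret H: fd_hilbert H by (rule H)
  have "c \<odot>\<^bsub>A\<^esub> a \<in> carrier A" if "a \<in> carrier A" for c a
    using A.vs.smult_closed[of c a] that by simp
  then have "(\<lambda>a\<in>carrier A. a) \<in> star_alg_hom A A"
    by (simp add: star_alg_hom_def Ring.ring_hom_def A.star_closed)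
  moreover have "c \<odot>\<^bsub>H\<^esub> v \<in> carrier H" if "v \<in> carrier H" for c v
    using H.vs.smult_closed[of c v] that by simp
  then have "(\<lambda>v\<in>carrier H. v) \<in> unitary_maps H H"
    by (simp add: unitary_maps_def module_hom_def bij_betw_def inj_on_def)
  moreover have "lam a v \<in> carrier H" if "a \<in> carrier A" "v \<in> carrier H" for a v
    using act that by (auto simp: is_star_action_def module_hom_def)
  ultimately have pair: "(\<lambda>a\<in>carrier A. a, \<lambda>v\<in>carrier H. v) \<in> pS_pairs X X"
    unfolding X' pS_pairs_iff[OF H] by simp
  then show "(\<lambda>a\<in>carrier (fst X). a) \<in> alg_maps X X"
    by (force simp: alg_maps_def X')
  show "pS_id X = alg_class X X (\<lambda>a\<in>carrier (fst X). a)"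
    using pS_rel_class[OF pair] by (simp add: pS_id_def X')
qed

lemma alg_maps_funcset: "\<phi> \<in> alg_maps X Y \<Longrightarrow> \<phi> \<in> carrier (fst X) \<rightarrow>\<^sub>E carrier (fst Y)"
  by (cases X; cases Y) (auto simp: alg_maps_def pS_pairs_def star_alg_hom_def Ring.ring_hom_def PiE_def)

section \<open>Functors on the path category\<close>

context pre_digraph
begin

fun path_map :: "('a \<Rightarrow> 'x set) \<Rightarrow> ('b \<Rightarrow> 'x \<Rightarrow> 'x) \<Rightarrow> 'a \<Rightarrow> 'b list \<Rightarrow> 'x \<Rightarrow> 'x" where
  "path_map A f u [] = (\<lambda>a\<in>A u. a)"
| "path_map A f u (e # p) = compose (A u) (path_map A f (head G e) p) (f e)"

lemma path_map_extensional: "path_map A f u p \<in> extensional (A u)"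
  by (cases p) auto

end

context wf_digraph
begin

text \<open>The domain of each \<open>f e\<close> must match the algebra at the tail of the arc, because composition of
  extensional maps is associative only for maps with matching domain and range.\<close>

lemma path_map_append:
  assumes f: "\<And>e. e \<in> arcs G \<Longrightarrow> f e \<in> A (tail G e) \<rightarrow> A (head G e)"
  shows "awalk u p v \<Longrightarrow> path_map A f u (p @ q) = compose (A u) (path_map A f v q) (path_map A f u p)"
proof (induction p arbitrary: u)
  case Nil
  then have "u = v" by (simp add: awalk_Nil_iff)
  then show ?case
    using path_map_extensional[of A f v q]
    by (auto simp: compose_def restrict_def extensional_def fun_eq_iff)
next
  case (Cons e p)
  then have e: "e \<in> arcs G" "u = tail G e" "awalk (head G e) p v"
    by (auto simp: awalk_Cons_iff)
  have "path_map A f u ((e # p) @ q) =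
      compose (A u) (compose (A (head G e)) (path_map A f v q) (path_map A f (head G e) p)) (f e)"
    using Cons.IH[OF e(3)] by simp
  also have "\<dots> = compose (A u) (path_map A f v q) (compose (A u) (path_map A f (head G e) p) (f e))"
    unfolding e(2) by (rule compose_assoc[OF f[OF e(1)], symmetric])
  finally show ?case by simp
qed

lemma path_map_alg_maps:
  assumes X: "\<And>v. v \<in> verts G \<Longrightarrow> prespectral_triple (X v)"
    and f: "\<And>e. e \<in> arcs G \<Longrightarrow> f e \<in> alg_maps (X (tail G e)) (X (head G e))"
  shows "awalk u p v \<Longrightarrow> path_map (\<lambda>v. carrier (fst (X v))) f u p \<in> alg_maps (X u) (X v)"
proof (induction p arbitrary: u)
  case Nil
  then have "u = v" "v \<in> verts G" by (auto simp: awalk_Nil_iff)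
  then show ?case using alg_maps_id(1)[OF X, of v] by (simp add: restrict_def)
next
  case (Cons e p)
  then have e: "e \<in> arcs G" "u = tail G e" "awalk (head G e) p v"
    by (auto simp: awalk_Cons_iff)
  show ?case
    using alg_maps_compose(1)[OF X X f Cons.IH[OF e(3)]] e by simp
qed

lemma rep_arc:
  assumes "(X, \<Phi>) \<in> Rep_pS G" "e \<in> arcs G"
  shows "\<exists>\<phi>\<in>alg_maps (X (tail G e)) (X (head G e)). fst ` \<Phi> (tail G e, [e], head G e) = {\<phi>}"
proof -
  have "(tail G e, [e], head G e) \<in> path_arrows G"
    using assms(2) by (simp add: path_arrows_def arc_implies_awalk)
  then have "\<Phi> (tail G e, [e], head G e) \<in> pS_hom (X (tail G e)) (X (head G e))"
    using assms(1) by (simp add: Rep_pS_def)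
  then show ?thesis by (auto simp: pS_hom_eq fst_alg_class)
qed

text \<open>A functor on a free category is determined by its values on generators, and the value on an arc
  is determined by its underlying algebra map.\<close>

lemma rep_determined_by_arcs:
  assumes "(X, \<Phi>) \<in> Rep_pS G" "(X, \<Psi>) \<in> Rep_pS G"
    and eq: "\<And>e. e \<in> arcs G \<Longrightarrow>
      fst ` \<Phi> (tail G e, [e], head G e) = fst ` \<Psi> (tail G e, [e], head G e)"
  shows "\<Phi> = \<Psi>"
proof -
  have hom: "\<Phi> (u, p, v) \<in> pS_hom (X u) (X v)" "\<Psi> (u, p, v) \<in> pS_hom (X u) (X v)" if "awalk u p v" for u p v
    using assms(1,2) that by (simp_all add: Rep_pS_def path_arrows_def)
  have arc: "\<Phi> (tail G e, [e], head G e) = \<Psi> (tail G e, [e], head G e)" if e: "e \<in> arcs G" for e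
  proof -
    obtain \<phi> where "fst ` \<Phi> (tail G e, [e], head G e) = {\<phi>}"
      using rep_arc[OF assms(1) e] by blast
    then show ?thesis
      using eq[OF e] pS_hom_cases(2)[OF hom(1)[OF arc_implies_awalk[OF e]]]
        pS_hom_cases(2)[OF hom(2)[OF arc_implies_awalk[OF e]]] by simp
  qed
  have "awalk u p v \<Longrightarrow> \<Phi> (u, p, v) = \<Psi> (u, p, v)" for u p v
  proof (induction p arbitrary: u)
    case Nil
    then have "u = v" "v \<in> verts G" by (auto simp: awalk_Nil_iff)
    then show ?case using assms(1,2) by (simp add: Rep_pS_def)
  next
    case (Cons e p)
    then have e: "e \<in> arcs G" "u = tail G e" "awalk (head G e) p v"
      by (auto simp: awalk_Cons_iff)
    have functorial: "\<Theta> (u, [e] @ p, v) = pS_comp (X u) (X v) (\<Theta> (head G e, p, v)) (\<Theta> (u, [e], head G e))"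
      if "(X, \<Theta>) \<in> Rep_pS G" for \<Theta>
      using that e arc_implies_awalk[OF e(1)] unfolding Rep_pS_def path_arrows_def by blast
    show ?case
      using functorial[OF assms(1)] functorial[OF assms(2)] Cons.IH[OF e(3)] arc[OF e(1)] e(2) by simp
  qed
  then have "\<Phi> x = \<Psi> x" if "x \<in> path_arrows G" for x
    using that by (auto simp: path_arrows_def)
  then show ?thesis
    using assms(1,2) by (intro extensionalityI[of \<Phi> "path_arrows G" \<Psi>]) (auto simp: Rep_pS_def)
qed

lemma rep_extends_arcs:
  assumes X: "X \<in> verts G \<rightarrow>\<^sub>E pS_objects"
    and f: "\<And>e. e \<in> arcs G \<Longrightarrow> f e \<in> alg_maps (X (tail G e)) (X (head G e))"
  shows "\<exists>\<Phi>. (X, \<Phi>) \<in> Rep_pS G \<and> (\<forall>e\<in>arcs G. fst ` \<Phi> (tail G e, [e], head G e) = {f e})"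
proof -
  define A where "A = (\<lambda>v. carrier (fst (X v)))"
  define \<Phi> where "\<Phi> = (\<lambda>(u, p, v)\<in>path_arrows G. alg_class (X u) (X v) (path_map A f u p))"
  have pre: "prespectral_triple (X v)" if "v \<in> verts G" for v
    using X that by (auto simp: pS_objects_def)
  have alg: "path_map A f u p \<in> alg_maps (X u) (X v)" if "awalk u p v" for u p v
    unfolding A_def by (rule path_map_alg_maps[OF pre f that])
  have fA: "f e \<in> A (tail G e) \<rightarrow>\<^sub>E A (head G e)" if "e \<in> arcs G" for e
    using alg_maps_funcset[OF f[OF that]] by (simp add: A_def)
  have \<Phi>: "\<Phi> (u, p, v) = alg_class (X u) (X v) (path_map A f u p)" if "awalk u p v" for u p v
    using that by (simp add: \<Phi>_def path_arrows_def)
  have "(X, \<Phi>) \<in> Rep_pS G"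
    unfolding Rep_pS_def
  proof (clarsimp simp: X, intro conjI allI impI ballI)
    show "\<Phi> \<in> extensional (path_arrows G)" by (simp add: \<Phi>_def)
  next
    fix u p v assume "(u, p, v) \<in> path_arrows G"
    then have w: "awalk u p v" by (simp add: path_arrows_def)
    show "\<Phi> (u, p, v) \<in> pS_hom (X u) (X v)"
      using alg[OF w] by (simp add: \<Phi>[OF w] pS_hom_eq)
  next
    fix v assume "v \<in> verts G"
    then show "\<Phi> (v, [], v) = pS_id (X v)"
      using alg_maps_id(2)[OF pre] by (simp add: \<Phi> awalk_Nil_iff A_def)
  next
    fix u p v q w assume "(u, p, v) \<in> path_arrows G" "(v, q, w) \<in> path_arrows G"
    then have w: "awalk u p v" "awalk v q w" by (simp_all add: path_arrows_def)
    have pq: "awalk u (p @ q) w" using w by (rule awalk_appendI)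
    have verts: "u \<in> verts G" "v \<in> verts G" using w by (auto dest: awalk_hd_in_verts)
    have append: "path_map A f u (p @ q) = compose (A u) (path_map A f v q) (path_map A f u p)"
      using fA by (intro path_map_append[OF _ w(1)]) (auto simp: PiE_def)
    show "\<Phi> (u, p @ q, w) = pS_comp (X u) (X w) (\<Phi> (v, q, w)) (\<Phi> (u, p, v))"
      using alg_maps_compose(2)[OF pre[OF verts(1)] pre[OF verts(2)] alg[OF w(1)] alg[OF w(2)]]
      by (simp add: \<Phi>[OF pq] \<Phi>[OF w(1)] \<Phi>[OF w(2)] append[unfolded A_def] A_def)
  qed
  moreover have "fst ` \<Phi> (tail G e, [e], head G e) = {f e}" if e: "e \<in> arcs G" for e
  proof -
    have "path_map A f (tail G e) [e] = f e"
      using fA[OF e] by (auto simp: compose_def PiE_def extensional_def fun_eq_iff)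
    then show ?thesis
      using \<Phi>[OF arc_implies_awalk[OF e]] fst_alg_class[OF f[OF e]] by simp
  qed
  ultimately show ?thesis by blast
qed

end

section \<open>Representations of a quiver\<close>

text \<open>The unit of the algebra shows the block sizes, and the traces of the images of the corners under the
  action show the multiplicities.\<close>

lemma X_obj_inj:
  assumes "X_obj ns rs = X_obj ms ss" "\<forall>k\<in>set ns. 0 < k" "length rs = length ns" "length ss = length ms"
  shows "ns = ms \<and> rs = ss"
proof
  have "map 1\<^sub>m ns = (map 1\<^sub>m ms :: complex mat list)"
    using arg_cong[OF assms(1), of "\<lambda>X. one (fst X)"] by (simp add: X_obj_def)
  from arg_cong[OF this, of "map dim_row"] show ns: "ns = ms" by (simp add: o_def)
  have act: "multiplicity_sum rs a *\<^sub>v v = multiplicity_sum ss a *\<^sub>v v" for a v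
    using assms(1) by (simp add: X_obj_def fun_eq_iff flip: std_action_eq)
  show "rs = ss"
  proof (rule nth_equalityI)
    show "length rs = length ss" using assms ns by simp
    fix i assume "i < length rs"
    then have i: "i < length ns" using assms(3) by simp
    have a: "corner ns i \<in> matrix_tuples ns" by simp
    note c1 = matrix_rep.carrier[OF matrix_rep_std[OF assms(3)] a]
    note c2 = matrix_rep.carrier[OF matrix_rep_std[OF assms(4), folded ns] a]
    have "sum_list (map2 (*) rs ns) = sum_list (map2 (*) ss ns)"
      using arg_cong[OF act[of "corner ns i"], of dim_vec] c1 c2 by simp
    then have "multiplicity_sum rs (corner ns i) = multiplicity_sum ss (corner ns i)"
      using c1 c2 act by (intro mat_eq_if_mult_vec_eq[of _ "sum_list (map2 (*) rs ns)" "sum_list (map2 (*) rs ns)"]) simp_all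
    then have "trace (multiplicity_sum rs (corner ns i)) = trace (multiplicity_sum ss (corner ns i))" by simp
    then show "rs ! i = ss ! i"
      using i assms ns by (simp add: trace_multiplicity_sum_corner)
  qed
qed

lemma network_arc:
  assumes "(n, r, C) \<in> bratteli_networks Q" "wf_digraph Q" "e \<in> arcs Q"
  shows "C e \<in> carrier_mat (length (n (tail Q e))) (length (n (head Q e)))"
    and "\<And>j. j < length (n (head Q e)) \<Longrightarrow>
      n (head Q e) ! j = (\<Sum>i<length (n (tail Q e)). C e $$ (i, j) * n (tail Q e) ! i)"
    and "\<And>i. i < length (n (tail Q e)) \<Longrightarrow>
      r (tail Q e) ! i = (\<Sum>j<length (n (head Q e)). C e $$ (i, j) * r (head Q e) ! j)"
proof -
  let ?s = "tail Q e" and ?t = "head Q e"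
  have C: "C e \<in> carrier_mat (length (n ?s)) (length (n ?t))"
    and n: "vec_of_list (n ?t) = transpose_mat (C e) *\<^sub>v vec_of_list (n ?s)"
    and r: "vec_of_list (r ?s) = C e *\<^sub>v vec_of_list (r ?t)"
    using assms(1,3) by (auto simp: bratteli_networks_def)
  show "C e \<in> carrier_mat (length (n ?s)) (length (n ?t))" by (rule C)
  have len: "length (r ?t) = length (n ?t)" "length (r ?s) = length (n ?s)"
    using assms wf_digraph.head_in_verts[OF assms(2,3)] wf_digraph.tail_in_verts[OF assms(2,3)]
    by (fastforce simp: bratteli_networks_def pos_tuples_def)+
  show "n ?t ! j = (\<Sum>i<length (n ?s). C e $$ (i, j) * n ?s ! i)" if "j < length (n ?t)" for j
    using arg_cong[OF n, of "\<lambda>v. v $ j"] C that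
    by (simp add: scalar_prod_def atLeast0LessThan vec_of_list_index)
  show "r ?s ! i = (\<Sum>j<length (n ?t). C e $$ (i, j) * r ?t ! j)" if "i < length (n ?s)" for i
    using arg_cong[OF r, of "\<lambda>v. v $ i"] C that len
    by (simp add: scalar_prod_def atLeast0LessThan vec_of_list_index)
qed

lemma network_vertex:
  assumes "(n, r, C) \<in> bratteli_networks Q" "v \<in> verts Q"
  shows "\<forall>k\<in>set (n v). 0 < k" "\<forall>k\<in>set (r v). 0 < k" "length (r v) = length (n v)"
    and "X_obj (n v) (r v) \<in> pS_objects"
proof -
  obtain l where l: "l > 0" "n v \<in> pos_tuples l" "r v \<in> pos_tuples l"
    using assms by (auto simp: bratteli_networks_def)
  then show 1: "\<forall>k\<in>set (n v). 0 < k" "\<forall>k\<in>set (r v). 0 < k" "length (r v) = length (n v)"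
    by (auto simp: pos_tuples_def)
  show "X_obj (n v) (r v) \<in> pS_objects"
    using X_obj_prespectral[OF 1(3,2)] l by (auto simp: pS_objects_def)
qed

lemma represents_iff:
  "represents Q ((n, r, C), u) (X, \<Phi>) \<longleftrightarrow> (\<forall>v\<in>verts Q. X v = X_obj (n v) (r v)) \<and>
    (\<forall>e\<in>arcs Q. fst ` \<Phi> (tail Q e, [e], head Q e) = {diagram_map (n (tail Q e)) (C e) (u e)})"
  by (simp add: represents_def diagram_map_def)

lemma coproduct_represents_unique_rep:
  assumes "fin_digraph Q" and x: "((n, r, C), u) \<in> network_coproduct Q"
  shows "\<exists>!R. R \<in> Rep_pS Q \<and> represents Q ((n, r, C), u) R"
proof -
  interpret fin_digraph Q by fact
  have net: "(n, r, C) \<in> bratteli_networks Q"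
    and u: "\<And>e. e \<in> arcs Q \<Longrightarrow> u e \<in> unitary_tuples (n (head Q e))"
    using x by (auto simp: network_coproduct_def)
  define X where "X = (\<lambda>v\<in>verts Q. X_obj (n v) (r v))"
  have X: "X \<in> verts Q \<rightarrow>\<^sub>E pS_objects"
    using network_vertex(4)[OF net] by (simp add: X_def)
  have f: "diagram_map (n (tail Q e)) (C e) (u e) \<in> alg_maps (X (tail Q e)) (X (head Q e))" if e: "e \<in> arcs Q" for e
  proof -
    have v: "tail Q e \<in> verts Q" "head Q e \<in> verts Q" using e by auto
    note arc = network_arc[OF net wf_digraph_axioms e]
    have "diagram_map (n (tail Q e)) (C e) (u e) \<in>
        alg_maps (X_obj (n (tail Q e)) (r (tail Q e))) (X_obj (n (head Q e)) (r (head Q e)))"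
      by (rule diagram_map_alg_map[OF arc(1) u[OF e] network_vertex(1)[OF net v(1)]
            network_vertex(3)[OF net v(1)] network_vertex(3)[OF net v(2)] arc(2,3)])
    then show ?thesis using v by (simp add: X_def)
  qed
  obtain \<Phi> where \<Phi>: "(X, \<Phi>) \<in> Rep_pS Q"
    "\<forall>e\<in>arcs Q. fst ` \<Phi> (tail Q e, [e], head Q e) = {diagram_map (n (tail Q e)) (C e) (u e)}"
    using rep_extends_arcs[of X "\<lambda>e. diagram_map (n (tail Q e)) (C e) (u e)", OF X f] by blast
  show ?thesis
  proof (rule ex1I[of _ "(X, \<Phi>)"])
    show "(X, \<Phi>) \<in> Rep_pS Q \<and> represents Q ((n, r, C), u) (X, \<Phi>)"
      using \<Phi> by (simp add: represents_iff X_def)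
    fix R assume R: "R \<in> Rep_pS Q \<and> represents Q ((n, r, C), u) R"
    obtain Y \<Psi> where Y: "R = (Y, \<Psi>)" by (cases R)
    have "Y \<in> extensional (verts Q)" using R by (auto simp: Rep_pS_def Y PiE_def)
    then have YX: "Y = X"
      using R by (intro extensionalityI[of Y "verts Q" X]) (simp_all add: X_def Y represents_iff)
    have "\<Psi> = \<Phi>"
      using R \<Phi> by (intro rep_determined_by_arcs[of X \<Psi> \<Phi>]) (simp_all add: Y YX represents_iff)
    then show "R = (X, \<Phi>)" using Y YX by simp
  qed
qed

lemma rep_has_coordinates:
  assumes "fin_digraph Q" and R: "(X, \<Phi>) \<in> Rep_pS Q"
  shows "\<exists>x\<in>network_coproduct Q. represents Q x (X, \<Phi>)"
proof -
  interpret fin_digraph Q by fact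
  have "\<forall>v\<in>verts Q. \<exists>p. X v = X_obj (fst p) (snd p) \<and> (\<exists>l>0. fst p \<in> pos_tuples l \<and> snd p \<in> pos_tuples l)"
    using R by (fastforce simp: Rep_pS_def pS_objects_def PiE_def Pi_iff)
  from bchoice[OF this] obtain p where p: "\<And>v. v \<in> verts Q \<Longrightarrow> X v = X_obj (fst (p v)) (snd (p v))"
    "\<And>v. v \<in> verts Q \<Longrightarrow> \<exists>l>0. fst (p v) \<in> pos_tuples l \<and> snd (p v) \<in> pos_tuples l"
    by blast
  define n where "n = (\<lambda>v\<in>verts Q. fst (p v))"
  define r where "r = (\<lambda>v\<in>verts Q. snd (p v))"
  have X: "X v = X_obj (n v) (r v)" and l: "\<exists>l>0. n v \<in> pos_tuples l \<and> r v \<in> pos_tuples l"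
    if "v \<in> verts Q" for v
    using p that by (simp_all add: n_def r_def)
  have len: "length (r v) = length (n v)" and pos: "\<forall>k\<in>set (n v). 0 < k" if "v \<in> verts Q" for v
    using l[OF that] by (auto simp: pos_tuples_def)
  have "\<forall>e\<in>arcs Q. \<exists>q. fst q \<in> carrier_mat (length (n (tail Q e))) (length (n (head Q e))) \<and>
    snd q \<in> unitary_tuples (n (head Q e)) \<and>
    (\<forall>j<length (n (head Q e)). n (head Q e) ! j = (\<Sum>i<length (n (tail Q e)). fst q $$ (i, j) * n (tail Q e) ! i)) \<and>
    (\<forall>i<length (n (tail Q e)). r (tail Q e) ! i = (\<Sum>j<length (n (head Q e)). fst q $$ (i, j) * r (head Q e) ! j)) \<and>
    fst ` \<Phi> (tail Q e, [e], head Q e) = {diagram_map (n (tail Q e)) (fst q) (snd q)}"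
  proof
    fix e assume e: "e \<in> arcs Q"
    then have v: "tail Q e \<in> verts Q" "head Q e \<in> verts Q" by auto
    from rep_arc[OF R e] obtain \<phi> where \<phi>: "\<phi> \<in> alg_maps (X (tail Q e)) (X (head Q e))"
      "fst ` \<Phi> (tail Q e, [e], head Q e) = {\<phi>}" by blast
    from alg_map_diagram[OF pos[OF v(1)] len[OF v(1)] len[OF v(2)] \<phi>(1)[unfolded X[OF v(1)] X[OF v(2)]]]
    show "\<exists>q. fst q \<in> carrier_mat (length (n (tail Q e))) (length (n (head Q e))) \<and>
      snd q \<in> unitary_tuples (n (head Q e)) \<and>
      (\<forall>j<length (n (head Q e)). n (head Q e) ! j = (\<Sum>i<length (n (tail Q e)). fst q $$ (i, j) * n (tail Q e) ! i)) \<and>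
      (\<forall>i<length (n (tail Q e)). r (tail Q e) ! i = (\<Sum>j<length (n (head Q e)). fst q $$ (i, j) * r (head Q e) ! j)) \<and>
      fst ` \<Phi> (tail Q e, [e], head Q e) = {diagram_map (n (tail Q e)) (fst q) (snd q)}"
      by (simp only: split_paired_Ex fst_conv snd_conv \<phi>(2)) blast
  qed
  from bchoice[OF this] obtain q where q: "\<And>e. e \<in> arcs Q \<Longrightarrow>
      fst (q e) \<in> carrier_mat (length (n (tail Q e))) (length (n (head Q e)))"
    "\<And>e. e \<in> arcs Q \<Longrightarrow> snd (q e) \<in> unitary_tuples (n (head Q e))"
    "\<And>e j. e \<in> arcs Q \<Longrightarrow> j < length (n (head Q e)) \<Longrightarrow>
      n (head Q e) ! j = (\<Sum>i<length (n (tail Q e)). fst (q e) $$ (i, j) * n (tail Q e) ! i)"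
    "\<And>e i. e \<in> arcs Q \<Longrightarrow> i < length (n (tail Q e)) \<Longrightarrow>
      r (tail Q e) ! i = (\<Sum>j<length (n (head Q e)). fst (q e) $$ (i, j) * r (head Q e) ! j)"
    "\<And>e. e \<in> arcs Q \<Longrightarrow>
      fst ` \<Phi> (tail Q e, [e], head Q e) = {diagram_map (n (tail Q e)) (fst (q e)) (snd (q e))}"
    by blast
  define C where "C = (\<lambda>e\<in>arcs Q. fst (q e))"
  define u where "u = (\<lambda>e\<in>arcs Q. snd (q e))"
  have "vec_of_list (n (head Q e)) = transpose_mat (C e) *\<^sub>v vec_of_list (n (tail Q e))"
    "vec_of_list (r (tail Q e)) = C e *\<^sub>v vec_of_list (r (head Q e))" if e: "e \<in> arcs Q" for e
  proof -
    have v: "tail Q e \<in> verts Q" "head Q e \<in> verts Q" using e by auto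
    show "vec_of_list (n (head Q e)) = transpose_mat (C e) *\<^sub>v vec_of_list (n (tail Q e))"
      using q(1)[OF e] q(3)[OF e] e
      by (intro eq_vecI) (simp_all add: C_def scalar_prod_def atLeast0LessThan vec_of_list_index)
    show "vec_of_list (r (tail Q e)) = C e *\<^sub>v vec_of_list (r (head Q e))"
      using q(1)[OF e] q(4)[OF e] e len[OF v(1)] len[OF v(2)]
      by (intro eq_vecI) (simp_all add: C_def scalar_prod_def atLeast0LessThan vec_of_list_index)
  qed
  then have "(n, r, C) \<in> bratteli_networks Q"
    using l q(1) by (simp add: bratteli_networks_def n_def r_def C_def)
  then have "((n, r, C), u) \<in> network_coproduct Q"
    using q(2) by (auto simp: network_coproduct_def u_def)
  moreover have "represents Q ((n, r, C), u) (X, \<Phi>)"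
    using X q(5) by (simp add: represents_iff C_def u_def)
  ultimately show ?thesis by blast
qed

lemma network_determined_by_rep:
  assumes "fin_digraph Q" and x: "((n, r, C), u) \<in> network_coproduct Q"
    and y: "((n', r', C'), u') \<in> network_coproduct Q"
    and "represents Q ((n, r, C), u) (X, \<Phi>)" "represents Q ((n', r', C'), u') (X, \<Phi>)"
  shows "(n, r, C) = (n', r', C')"
proof -
  interpret fin_digraph Q by fact
  have net: "(n, r, C) \<in> bratteli_networks Q" and net': "(n', r', C') \<in> bratteli_networks Q"
    and u: "\<And>e. e \<in> arcs Q \<Longrightarrow> u e \<in> unitary_tuples (n (head Q e))"
    and u': "\<And>e. e \<in> arcs Q \<Longrightarrow> u' e \<in> unitary_tuples (n' (head Q e))"
    using x y by (auto simp: network_coproduct_def)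
  have ext: "n \<in> extensional (verts Q)" "r \<in> extensional (verts Q)" "C \<in> extensional (arcs Q)"
    "n' \<in> extensional (verts Q)" "r' \<in> extensional (verts Q)" "C' \<in> extensional (arcs Q)"
    using net net' by (simp_all add: bratteli_networks_def)
  have v: "n v = n' v \<and> r v = r' v" if "v \<in> verts Q" for v
  proof (rule X_obj_inj)
    show "X_obj (n v) (r v) = X_obj (n' v) (r' v)"
      using assms(4,5) that by (simp add: represents_iff)
  qed (use network_vertex[OF net that] network_vertex[OF net' that] in simp_all)
  have n: "n = n'" and r: "r = r'"
    using v ext extensionalityI[of n "verts Q" n'] extensionalityI[of r "verts Q" r'] by auto
  have "C e = C' e" if e: "e \<in> arcs Q" for e
  proof -
    have verts: "tail Q e \<in> verts Q" "head Q e \<in> verts Q" using e by auto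
    note arc = network_arc[OF net wf_digraph_axioms e]
    note arc' = network_arc[OF net' wf_digraph_axioms e, folded n r]
    have eq: "diagram_map (n (tail Q e)) (C e) (u e) = diagram_map (n (tail Q e)) (C' e) (u' e)"
      using assms(4,5) e n by (simp add: represents_iff)
    show ?thesis
    proof (rule eq_matI)
      fix i j assume "i < dim_row (C' e)" "j < dim_col (C' e)"
      then have ij: "i < length (n (tail Q e))" "j < length (n (head Q e))" using arc'(1) by simp_all
      then have pos: "0 < n (tail Q e) ! i" using network_vertex(1)[OF net verts(1)] by simp
      have "(of_nat (C e $$ (i, j)) :: complex) = of_nat (C' e $$ (i, j))"
        using trace_diagram_map[OF arc(1) u[OF e] arc(2) ij(1) pos ij(2)]
          trace_diagram_map[OF arc'(1) u'[OF e, folded n] arc'(2) ij(1) pos ij(2)] eq by simp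
      then show "C e $$ (i, j) = C' e $$ (i, j)" by (rule of_nat_eq_iff[THEN iffD1])
    qed (use arc(1) arc'(1) in simp_all)
  qed
  then have "C = C'" using ext extensionalityI[of C "arcs Q" C'] by blast
  with n r show ?thesis by simp
qed

theorem lemma3p15:
  fixes Q :: "('v, 'e) pre_digraph"
  assumes "fin_digraph Q"
  shows "(\<forall>x\<in>network_coproduct Q. \<exists>!R. R \<in> Rep_pS Q \<and> represents Q x R) \<and>
    (\<forall>R\<in>Rep_pS Q. \<exists>x\<in>network_coproduct Q. represents Q x R) \<and>
    (\<forall>x\<in>network_coproduct Q. \<forall>y\<in>network_coproduct Q. \<forall>R\<in>Rep_pS Q.
       represents Q x R \<longrightarrow> represents Q y R \<longrightarrow> fst x = fst y)"
proof (intro conjI ballI impI)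
  fix x assume x: "x \<in> network_coproduct Q"
  obtain n r C u where eq: "x = ((n, r, C), u)" by (metis prod.exhaust)
  show "\<exists>!R. R \<in> Rep_pS Q \<and> represents Q x R"
    unfolding eq by (rule coproduct_represents_unique_rep[OF assms x[unfolded eq]])
next
  fix R assume R: "R \<in> Rep_pS Q"
  obtain X \<Phi> where eq: "R = (X, \<Phi>)" by (cases R)
  show "\<exists>x\<in>network_coproduct Q. represents Q x R"
    unfolding eq by (rule rep_has_coordinates[OF assms R[unfolded eq]])
next
  fix x y R assume x: "x \<in> network_coproduct Q" and y: "y \<in> network_coproduct Q"
    and rep: "represents Q x R" "represents Q y R"
  obtain n r C u where eqx: "x = ((n, r, C), u)" by (metis prod.exhaust)
  obtain n' r' C' u' where eqy: "y = ((n', r', C'), u')" by (metis prod.exhaust)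
  obtain X \<Phi> where eq: "R = (X, \<Phi>)" by (cases R)
  show "fst x = fst y"
    using network_determined_by_rep[OF assms x[unfolded eqx] y[unfolded eqy] rep(1)[unfolded eqx eq]
        rep(2)[unfolded eqy eq]] by (simp add: eqx eqy)
qed

end
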